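(* Let $PD(n)$ denote the number of partitions of $n$ with designated summands. Then, as formal power series in $q$ (equivalently for $|q|<1$), $$\sum_{n=0}^{\infty} PD(3n+2)q^n = 3\,\frac{(q^3;q^6)_\infty^3\,(q^6;q^6)_\infty^6}{(q;q^2)_\infty^5\,(q^2;q^2)_\infty^8}.$$
   Context: A partition of $n$ with designated summands is an ordinary partition of $n$ in which, for each part size that occurs, exactly one of the parts of that size is designated (marked); if a size $t$ occurs $m_t$ times, the copies of $t$ are regarded as ordered and the designation may be placed on any one of the $m_t$ positions, different positions giving different objects (e.g. $2'+2$ and $2+2'$ are distinct). $PD(n)$ is the number of such objects, with $PD(0)=1$. Notation: $(a;q)_\infty=\prod_{n\ge1}(1-aq^{n-1})$. *)

theory Defs
  imports "HOL-Analysis.Analysis"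
begin

text \<open>
  A partition of \<open>n\<close> with designated summands is a pair of a multiset \<open>m\<close> of positive parts
  summing to \<open>n\<close> and a map \<open>d\<close> that assigns to every part size \<open>t\<close> occurring in \<open>m\<close> the
  position, among the \<open>count m t\<close> ordered copies of \<open>t\<close>, of the designated copy.  The map is
  extensional (it is \<open>undefined\<close> off the set of part sizes), so that every object is counted once.
\<close>

definition designated_partitions :: "nat \<Rightarrow> (nat multiset \<times> (nat \<Rightarrow> nat)) set" where
  "designated_partitions n =
     {(m, d). 0 \<notin># m \<and> sum_mset m = n \<and> d \<in> (\<Pi>\<^sub>E t\<in>set_mset m. {1..count m t})}"

definition PD :: "nat \<Rightarrow> nat" where
  "PD n = card (designated_partitions n)"

text \<open>
  The \<open>q\<close>-Pochhammer symbol \<open>(a; q)\<^sub>\<infinity>\<close>, with the product indexed from \<open>0\<close>.  On formal power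
  series the limit is taken in the coefficientwise topology; see
  \<open>has_prod_qpochhammer_inf_fps\<close> below for convergence.
\<close>

definition qpochhammer_inf :: "'a::{comm_ring_1,t2_space} \<Rightarrow> 'a \<Rightarrow> 'a" where
  "qpochhammer_inf a q = (\<Prod>k. 1 - a * q ^ k)"

lemma size_le_sum_mset: "0 \<notin># m \<Longrightarrow> size m \<le> sum_mset (m :: nat multiset)"
  by (induction m) auto

lemma finite_designated_partitions: "finite (designated_partitions n)"
proof -
  let ?M = "{m :: nat multiset. 0 \<notin># m \<and> sum_mset m = n}"
  have "?M \<subseteq> mset ` {xs. set xs \<subseteq> {..n} \<and> length xs \<le> n}"
  proof
    fix m assume m: "m \<in> ?M"
    obtain xs where xs: "mset xs = m" using ex_mset by blast
    have "set xs \<subseteq> {..n}"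
    proof
      fix x assume "x \<in> set xs"
      then obtain m' where "m = add_mset x m'"
        using xs by (metis mset_add set_mset_mset)
      thus "x \<in> {..n}" using m by simp
    qed
    moreover have "length xs \<le> n"
      using m xs size_le_sum_mset[of m] by auto
    ultimately show "m \<in> mset ` {xs. set xs \<subseteq> {..n} \<and> length xs \<le> n}"
      using xs by blast
  qed
  hence fin: "finite ?M"
    by (rule finite_subset) (simp add: finite_lists_length_le)
  have "designated_partitions n = (SIGMA m:?M. \<Pi>\<^sub>E t\<in>set_mset m. {1..count m t})"
    by (auto simp: designated_partitions_def)
  thus ?thesis
    using fin by (auto intro!: finite_SigmaI finite_PiE)
qed

lemma PD_0: "PD 0 = 1"
proof -
  have *: "0 \<notin># m \<and> sum_mset m = 0 \<longleftrightarrow> m = {#}" for m :: "nat multiset"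
  proof
    assume "0 \<notin># m \<and> sum_mset m = 0"
    hence "size m \<le> 0"
      using size_le_sum_mset[of m] by metis
    thus "m = {#}" by (simp only: le_zero_eq size_eq_0_iff_empty)
  qed simp
  have "designated_partitions 0 = {(m, d). m = {#} \<and> d \<in> (\<Pi>\<^sub>E t\<in>set_mset m. {1..count m t})}"
    unfolding designated_partitions_def by (simp only: conj_assoc[symmetric] *)
  also have "\<dots> = {({#}, \<lambda>_. undefined)}"
    by auto
  finally have "designated_partitions 0 = {({#}, \<lambda>_. undefined)}" .
  thus ?thesis by (simp add: PD_def)
qed

lemma fps_nth_prod_qpochhammer:
  fixes a q :: "'a::idom fps"
  assumes q: "fps_nth q 0 = 0" and "n \<le> N"
  shows "fps_nth (\<Prod>k\<le>N. 1 - a * q ^ k) n = fps_nth (\<Prod>k\<le>n. 1 - a * q ^ k) n"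
  using \<open>n \<le> N\<close>
proof (induction N rule: dec_induct)
  case (step N)
  define P where "P = (\<Prod>k\<le>N. 1 - a * q ^ k)"
  have "q = fps_X * fps_shift 1 q"
    by (intro fps_ext) (use q in auto)
  then obtain r where "q = fps_X * r" ..
  hence "P * (a * q ^ Suc N) = fps_X ^ Suc N * (P * a * r ^ Suc N)"
    by (simp only: power_mult_distrib mult_ac)
  hence "fps_nth (P * (a * q ^ Suc N)) n = 0"
    using step.hyps by (simp only: fps_X_power_mult_nth) simp
  moreover have "(\<Prod>k\<le>Suc N. 1 - a * q ^ k) = P - P * (a * q ^ Suc N)"
    by (simp add: P_def algebra_simps)
  ultimately show ?case
    using step.IH by (simp add: P_def)
qed simp

lemma has_prod_qpochhammer_inf_fps:
  fixes a q :: "'a::idom fps"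
  assumes "fps_nth a 0 = 0" "fps_nth q 0 = 0"
  shows "(\<lambda>k. 1 - a * q ^ k) has_prod qpochhammer_inf a q"
proof -
  define L where "L = Abs_fps (\<lambda>n. fps_nth (\<Prod>k\<le>n. 1 - a * q ^ k) n)"
  have "(\<lambda>N. \<Prod>k\<le>N. 1 - a * q ^ k) \<longlonglongrightarrow> L"
  proof (rule tendsto_fpsI)
    fix n
    show "\<forall>\<^sub>F N in sequentially. fps_nth (\<Prod>k\<le>N. 1 - a * q ^ k) n = fps_nth L n"
      using eventually_ge_at_top[of n]
      by eventually_elim (simp only: L_def fps_nth_Abs_fps, rule fps_nth_prod_qpochhammer[OF assms(2)])
  qed
  moreover have "fps_nth L 0 = 1"
    by (simp add: L_def assms)
  hence "L \<noteq> 0"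
    by auto
  ultimately have "(\<lambda>k. 1 - a * q ^ k) has_prod L"
    by (simp add: has_prod_def raw_has_prod_def)
  moreover from this have "qpochhammer_inf a q = L"
    unfolding qpochhammer_inf_def by (rule has_prod_unique[symmetric])
  ultimately show ?thesis
    by simp
qed

end

theory Submission
  imports Defs
begin

text \<open>
  Write \<open>E\<^sub>k = (q\<^sup>k; q\<^sup>k)\<^sub>\<infinity>\<close>.  A part size \<open>t\<close> contributes the factor
  \<open>1 + q\<^sup>t / (1 - q\<^sup>t)\<^sup>2\<close>, so the generating function \<open>G\<close> of \<open>PD\<close> is \<open>E\<^sub>6 / (E\<^sub>1 E\<^sub>2 E\<^sub>3)\<close>.
  Gauss's theta products give \<open>E\<^sub>1 E\<^sub>2 = \<phi>(-q) \<psi>(q)\<close>, and sorting the exponents of the theta series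
  modulo 3 with the Jacobi triple product gives \<open>\<phi>(-q) = P - 2qB\<close> and \<open>\<psi>(q) = C + qS\<close> with \<open>P, B, C, S\<close> series in
  \<open>q\<^sup>3\<close> satisfying \<open>PS = BC = E\<^sub>9 E\<^sub>1\<^sub>8\<close>.  If \<open>M\<close> is the product of the conjugates of \<open>E\<^sub>1 E\<^sub>2\<close> under
  \<open>q \<mapsto> \<omega>q, \<omega>\<^sup>2q\<close> for a primitive cube root of unity \<open>\<omega>\<close>, then \<open>E\<^sub>1 E\<^sub>2 M = (E\<^sub>3 E\<^sub>6)\<^sup>4 / (E\<^sub>9 E\<^sub>1\<^sub>8)\<close>, whence
  \<open>G E\<^sub>3\<^sup>5 E\<^sub>6\<^sup>3 = E\<^sub>9 E\<^sub>1\<^sub>8 M\<close>.  The part of \<open>M\<close> with exponents congruent to 2 modulo 3 is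
  \<open>3q\<^sup>2 (E\<^sub>9 E\<^sub>1\<^sub>8)\<^sup>2\<close>, and comparing these exponents on both sides yields the claim.
\<close>

unbundle no vec_syntax and fps_syntax

subsection \<open>Infinite products of power series\<close>

text \<open>Convergence means that each coefficient is eventually constant. Continuity of addition
  serves the splitting of \<open>has_sum\<close> over residue classes; that of multiplication, shown
  next, gives limits of products.\<close>

instance fps :: (ab_group_add) topological_comm_monoid_add
proof
  fix a b :: "'a fps"
  show "LIM x (nhds a \<times>\<^sub>F nhds b). fst x + snd x :> nhds (a + b)"
  proof (rule tendsto_fpsI)
    fix n
    have "\<forall>\<^sub>F x in nhds a. x $ n = a $ n" "\<forall>\<^sub>F x in nhds b. x $ n = b $ n"
      using filterlim_ident[of "nhds a"] filterlim_ident[of "nhds b"] unfolding tendsto_fps_iff by blast+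
    hence "\<forall>\<^sub>F x in nhds a \<times>\<^sub>F nhds b. fst x $ n = a $ n \<and> snd x $ n = b $ n"
      by (rule eventually_prodI)
    thus "\<forall>\<^sub>F x in nhds a \<times>\<^sub>F nhds b. (fst x + snd x) $ n = (a + b) $ n"
      by eventually_elim simp
  qed
qed

instance fps :: (ring) topological_semigroup_mult
proof
  fix a b :: "'a fps"
  have ev: "\<forall>\<^sub>F x in nhds c. \<forall>i\<in>{..n}. x $ i = c $ i" for c :: "'a fps" and n
    using filterlim_ident[of "nhds c"] unfolding tendsto_fps_iff
    by (intro eventually_ball_finite) auto
  show "LIM x (nhds a \<times>\<^sub>F nhds b). fst x * snd x :> nhds (a * b)"
  proof (rule tendsto_fpsI)
    fix n
    have "\<forall>\<^sub>F x in nhds a \<times>\<^sub>F nhds b. (\<forall>i\<in>{..n}. fst x $ i = a $ i) \<and> (\<forall>i\<in>{..n}. snd x $ i = b $ i)"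
      by (rule eventually_prodI[OF ev ev])
    thus "\<forall>\<^sub>F x in nhds a \<times>\<^sub>F nhds b. (fst x * snd x) $ n = (a * b) $ n"
      by eventually_elim (auto simp: fps_mult_nth intro!: sum.cong)
  qed
qed

instance fps :: (ring_1) topological_monoid_mult ..

instance fps :: (comm_ring_1) topological_comm_monoid_mult ..

section \<open>Partial products of q-Pochhammer symbols\<close>

lemma qpochhammer_inf_LIMSEQ:
  fixes a q :: "'a::idom fps"
  assumes "a $ 0 = 0" "q $ 0 = 0"
  shows "(\<lambda>n. \<Prod>k<n. 1 - a * q ^ k) \<longlonglongrightarrow> qpochhammer_inf a q"
proof -
  \<comment> \<open>\<open>has_prod\<close> discounts vanishing factors; here every factor has
    constant term 1, so the plain partial products converge.\<close>
  have nz: "1 - a * q ^ k \<noteq> 0" for k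
  proof
    assume "1 - a * q ^ k = 0"
    hence "(1 - a * q ^ k) $ 0 = 0" by simp
    thus False using assms by simp
  qed
  have "(\<lambda>n. \<Prod>k\<le>n. 1 - a * q ^ k) \<longlonglongrightarrow> qpochhammer_inf a q"
    using has_prod_qpochhammer_inf_fps[OF assms] nz
    by (auto simp: has_prod_def raw_has_prod_def)
  thus ?thesis
    by (subst filterlim_sequentially_Suc[symmetric]) (simp add: lessThan_Suc_atMost)
qed

lemma qpochhammer_inf_eqI:
  fixes a q :: "'a::idom fps"
  assumes "a $ 0 = 0" "q $ 0 = 0" "(\<lambda>n. \<Prod>k<n. 1 - a * q ^ k) \<longlonglongrightarrow> L"
  shows "qpochhammer_inf a q = L"
  using LIMSEQ_unique qpochhammer_inf_LIMSEQ assms by blast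

text \<open>The factor of index \<open>k\<close> differs from 1 only beyond degree \<open>k\<close>,
  so coefficient \<open>n\<close> is settled after \<open>n + 1\<close> factors.\<close>

lemma fps_nth_qpochhammer_inf:
  fixes a q :: "'a::idom fps"
  assumes "a $ 0 = 0" "q $ 0 = 0" "n < N"
  shows "qpochhammer_inf a q $ n = (\<Prod>k<N. 1 - a * q ^ k) $ n"
proof -
  obtain M where M: "\<And>m. m \<ge> M \<Longrightarrow> (\<Prod>k<m. 1 - a * q ^ k) $ n = qpochhammer_inf a q $ n"
    using qpochhammer_inf_LIMSEQ[OF assms(1,2)]
    unfolding tendsto_fps_iff eventually_sequentially by blast
  have stable: "(\<Prod>k<m. 1 - a * q ^ k) $ n = (\<Prod>k\<le>n. 1 - a * q ^ k) $ n" if "n < m" for m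
    using fps_nth_prod_qpochhammer[OF assms(2), of n "m - 1" a] that
    by (cases m) (auto simp: lessThan_Suc_atMost)
  show ?thesis
    using M[of "max M N"] stable[of "max M N"] stable[of N] assms(3) by simp
qed

lemma qpochhammer_inf_nth_0 [simp]:
  fixes a q :: "'a::idom fps"
  assumes "a $ 0 = 0" "q $ 0 = 0"
  shows "qpochhammer_inf a q $ 0 = 1"
  using fps_nth_qpochhammer_inf[OF assms, of 0 1] assms by simp

lemma qpochhammer_inf_nonzero:
  fixes a q :: "'a::idom fps"
  assumes "a $ 0 = 0" "q $ 0 = 0"
  shows "qpochhammer_inf a q \<noteq> 0"
  using qpochhammer_inf_nth_0[OF assms] by auto

text \<open>Sort the factors by index modulo \<open>m\<close>: the first \<open>n\<close> of every
  class make up the first \<open>n * m\<close> of all, a subsequence of the partial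
  products.\<close>

lemma qpochhammer_inf_split:
  fixes a q :: "'a::idom fps"
  assumes a: "a $ 0 = 0" and q: "q $ 0 = 0" and m: "m > 0"
  shows "qpochhammer_inf a q = (\<Prod>i<m. qpochhammer_inf (a * q ^ i) (q ^ m))"
proof (rule qpochhammer_inf_eqI[OF a q])
  have "(\<lambda>n. \<Prod>i<m. \<Prod>k<n. 1 - a * q ^ i * (q ^ m) ^ k) \<longlonglongrightarrow>
      (\<Prod>i<m. qpochhammer_inf (a * q ^ i) (q ^ m))"
    using m a q by (intro tendsto_prod' qpochhammer_inf_LIMSEQ) auto
  also have "(\<lambda>n. \<Prod>i<m. \<Prod>k<n. 1 - a * q ^ i * (q ^ m) ^ k) = (\<lambda>n. \<Prod>k<n * m. 1 - a * q ^ k)"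
    by (subst prod.swap)
       (simp add: prod.nat_group[symmetric] prod.atLeastLessThan_shift_0[of _ "_ * m"]
         atLeast0LessThan power_add power_mult[symmetric] mult_ac)
  finally have "(\<lambda>n. \<Prod>k<n * m. 1 - a * q ^ k) \<longlonglongrightarrow> (\<Prod>i<m. qpochhammer_inf (a * q ^ i) (q ^ m))" .
  moreover have "strict_mono (\<lambda>n. n * m)"
    using m by (simp add: strict_mono_def)
  hence "(\<lambda>n. \<Prod>k<n * m. 1 - a * q ^ k) \<longlonglongrightarrow> qpochhammer_inf a q"
    using LIMSEQ_subseq_LIMSEQ[OF qpochhammer_inf_LIMSEQ[OF a q]] by (simp add: o_def)
  ultimately have "qpochhammer_inf a q = (\<Prod>i<m. qpochhammer_inf (a * q ^ i) (q ^ m))"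
    by (rule LIMSEQ_unique[symmetric])
  thus "(\<lambda>n. \<Prod>k<n. 1 - a * q ^ k) \<longlonglongrightarrow> (\<Prod>i<m. qpochhammer_inf (a * q ^ i) (q ^ m))"
    using qpochhammer_inf_LIMSEQ[OF a q] by simp
qed

lemma qpochhammer_inf_minus_mult:
  fixes a q :: "'a::idom fps"
  assumes a: "a $ 0 = 0" and q: "q $ 0 = 0"
  shows "qpochhammer_inf a q * qpochhammer_inf (-a) q = qpochhammer_inf (a ^ 2) (q ^ 2)"
proof (rule qpochhammer_inf_eqI[symmetric])
  have "(\<lambda>n. (\<Prod>k<n. 1 - a * q ^ k) * (\<Prod>k<n. 1 - (-a) * q ^ k)) \<longlonglongrightarrow>
      qpochhammer_inf a q * qpochhammer_inf (-a) q"
    using a q by (intro tendsto_mult qpochhammer_inf_LIMSEQ) auto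
  thus "(\<lambda>n. \<Prod>k<n. 1 - a ^ 2 * (q ^ 2) ^ k) \<longlonglongrightarrow> qpochhammer_inf a q * qpochhammer_inf (-a) q"
    by (simp add: prod.distrib[symmetric] algebra_simps power2_eq_square power_mult_distrib)
qed (use a q in simp_all)

lemma qpochhammer_inf_cube_root_mult:
  fixes a q w :: "'a::idom fps"
  assumes a: "a $ 0 = 0" and q: "q $ 0 = 0" and w: "w ^ 2 + w + 1 = 0"
  shows "qpochhammer_inf a q * qpochhammer_inf (w * a) q * qpochhammer_inf (w ^ 2 * a) q =
    qpochhammer_inf (a ^ 3) (q ^ 3)"
proof (rule qpochhammer_inf_eqI[symmetric])
  have *: "(1 - x) * (1 - w * x) * (1 - w ^ 2 * x) = 1 - x ^ 3" for x
    using w by algebra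
  have **: "(1 - a * q ^ k) * ((1 - w * (a * q ^ k)) * (1 - w ^ 2 * (a * q ^ k))) = 1 - a ^ 3 * (q ^ 3) ^ k" for k
    using *[of "a * q ^ k"] by (simp only: mult.assoc power_mult_distrib power_mult[symmetric] mult.commute[of k 3])
  have "(\<lambda>n. (\<Prod>k<n. 1 - a * q ^ k) * (\<Prod>k<n. 1 - w * a * q ^ k) * (\<Prod>k<n. 1 - w ^ 2 * a * q ^ k)) \<longlonglongrightarrow>
      qpochhammer_inf a q * qpochhammer_inf (w * a) q * qpochhammer_inf (w ^ 2 * a) q"
    using a q by (intro tendsto_mult qpochhammer_inf_LIMSEQ) auto
  also have "(\<lambda>n. (\<Prod>k<n. 1 - a * q ^ k) * (\<Prod>k<n. 1 - w * a * q ^ k) * (\<Prod>k<n. 1 - w ^ 2 * a * q ^ k)) =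
      (\<lambda>n. \<Prod>k<n. 1 - a ^ 3 * (q ^ 3) ^ k)"
    by (simp only: prod.distrib[symmetric] ** mult.assoc)
  finally show "(\<lambda>n. \<Prod>k<n. 1 - a ^ 3 * (q ^ 3) ^ k) \<longlonglongrightarrow>
      qpochhammer_inf a q * qpochhammer_inf (w * a) q * qpochhammer_inf (w ^ 2 * a) q" .
qed (use a q in simp_all)

text \<open>By \<open>cont\<close> the map respects truncation, so each coefficient comes from a
  finite product, where the ring laws suffice. This serves both substitution and the passage from
  rational to complex coefficients.\<close>

lemma qpochhammer_inf_hom:
  fixes h :: "'a::idom fps \<Rightarrow> 'b::idom fps"
  assumes hom: "h 1 = 1" "\<And>f g. h (f * g) = h f * h g" "\<And>f g. h (f - g) = h f - h g"
    and cont: "\<And>f g n. (\<And>i. i \<le> n \<Longrightarrow> f $ i = g $ i) \<Longrightarrow> h f $ n = h g $ n"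
    and zero: "a $ 0 = 0" "q $ 0 = 0" "h a $ 0 = 0" "h q $ 0 = 0"
  shows "h (qpochhammer_inf a q) = qpochhammer_inf (h a) (h q)"
proof (rule fps_ext)
  fix n
  have pow: "h (f ^ k) = h f ^ k" for f k
    by (induction k) (simp_all add: hom)
  have prod: "h (\<Prod>k<m. f k) = (\<Prod>k<m. h (f k))" for f and m :: nat
    by (induction m) (simp_all add: hom)
  have "h (qpochhammer_inf a q) $ n = h (\<Prod>k<Suc n. 1 - a * q ^ k) $ n"
    by (intro cont fps_nth_qpochhammer_inf zero) auto
  also have "\<dots> = qpochhammer_inf (h a) (h q) $ n"
    by (simp only: prod hom pow fps_nth_qpochhammer_inf[OF zero(3,4) lessI])
  finally show "h (qpochhammer_inf a q) $ n = qpochhammer_inf (h a) (h q) $ n" .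
qed

lemma qpochhammer_inf_compose:
  fixes a q c :: "'a::idom fps"
  assumes "a $ 0 = 0" "q $ 0 = 0" "c $ 0 = 0"
  shows "qpochhammer_inf a q oo c = qpochhammer_inf (a oo c) (q oo c)"
  by (rule qpochhammer_inf_hom)
     (use assms in \<open>auto simp: fps_compose_mult_distrib fps_compose_sub_distrib fps_compose_nth\<close>)

subsection \<open>The Jacobi triple product\<close>

text \<open>The Gaussian binomial coefficient, given by a q-Pascal rule to avoid division.\<close>

fun qbinomial :: "'a::comm_ring_1 \<Rightarrow> nat \<Rightarrow> nat \<Rightarrow> 'a" where
  "qbinomial q n 0 = 1"
| "qbinomial q 0 (Suc k) = 0"
| "qbinomial q (Suc n) (Suc k) = qbinomial q n (Suc k) + q ^ (n - k) * qbinomial q n k"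

lemma qbinomial_eq_0: "n < k \<Longrightarrow> qbinomial q n k = 0"
  by (induction q n k rule: qbinomial.induct) auto

lemma qbinomial_self [simp]: "qbinomial q n n = 1"
  by (induction n) (auto simp: qbinomial_eq_0)

text \<open>With \<open>n = k + m + 1\<close> the q-Pascal rule reduces the induction step to
  \<open>1 - q^(n+1) = (1 - q^(m+1)) + q^(m+1) * (1 - q^(k+1))\<close>.\<close>

lemma qbinomial_mult_qfactorials:
  assumes "k \<le> n"
  shows "qbinomial q n k * (\<Prod>i<k. 1 - q ^ Suc i) * (\<Prod>i<n - k. 1 - q ^ Suc i) = (\<Prod>i<n. 1 - q ^ Suc i)"
  using assms
proof (induction q n k rule: qbinomial.induct)
  case (3 q n k)
  show ?case
  proof (cases "k = n")
    case False
    then obtain m where m: "n = k + Suc m"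
      using "3.prems" by (metis Suc_le_mono le_neq_implies_less less_iff_Suc_add add_Suc_right)
    define A B where "A = (\<Prod>i<k. 1 - q ^ Suc i)" and "B = (\<Prod>i<m. 1 - q ^ Suc i)"
    define P where "P = (\<Prod>i<n. 1 - q ^ Suc i)"
    have 1: "qbinomial q n (Suc k) * (A * (1 - q ^ Suc k)) * B = P"
      using "3.IH"(1) m by (simp add: A_def B_def P_def)
    have 2: "qbinomial q n k * A * (B * (1 - q ^ Suc m)) = P"
      using "3.IH"(2) m by (simp add: A_def B_def P_def)
    have "(qbinomial q n (Suc k) + q ^ Suc m * qbinomial q n k) * (A * (1 - q ^ Suc k)) * (B * (1 - q ^ Suc m)) =
        (qbinomial q n (Suc k) * (A * (1 - q ^ Suc k)) * B) * (1 - q ^ Suc m) +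
        q ^ Suc m * (qbinomial q n k * A * (B * (1 - q ^ Suc m))) * (1 - q ^ Suc k)"
      by (simp only: algebra_simps)
    also have "\<dots> = P * (1 - q ^ Suc m) + q ^ Suc m * P * (1 - q ^ Suc k)"
      unfolding 1 2 ..
    also have "\<dots> = P * (1 - q ^ Suc n)"
      unfolding m by (simp add: algebra_simps power_add)
    finally show ?thesis
      using m by (simp add: A_def B_def P_def mult_ac)
  qed (simp add: qbinomial_eq_0)
qed simp_all

lemma fps_nth_prod_0: "(\<Prod>x\<in>A. f x :: 'a::comm_ring_1 fps) $ 0 = (\<Prod>x\<in>A. f x $ 0)"
  by (induction A rule: infinite_finite_induct) auto

text \<open>The other q-Pascal rule: both sides agree after multiplication by the q-factorials
  \<open>C\<close>, which have constant term 1 and cancel.\<close>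

lemma qbinomial_Suc_Suc':
  fixes q :: "'a::idom fps"
  assumes q: "q $ 0 = 0"
  shows "qbinomial q (Suc n) (Suc k) = qbinomial q n k + q ^ Suc k * qbinomial q n (Suc k)"
proof (cases "k < n")
  case True
  then obtain m where m: "n = k + Suc m"
    by (metis less_iff_Suc_add add_Suc_right)
  define A B where "A = (\<Prod>i<k. 1 - q ^ Suc i)" and "B = (\<Prod>i<m. 1 - q ^ Suc i)"
  define P where "P = (\<Prod>i<n. 1 - q ^ Suc i)"
  define C where "C = A * (1 - q ^ Suc k) * (B * (1 - q ^ Suc m))"
  have 1: "qbinomial q n (Suc k) * (A * (1 - q ^ Suc k)) * B = P"
    using qbinomial_mult_qfactorials[of "Suc k" n q] m by (simp add: A_def B_def P_def)
  have 2: "qbinomial q n k * A * (B * (1 - q ^ Suc m)) = P"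
    using qbinomial_mult_qfactorials[of k n q] m by (simp add: A_def B_def P_def)
  have 3: "qbinomial q (Suc n) (Suc k) * C = P * (1 - q ^ Suc n)"
    using qbinomial_mult_qfactorials[of "Suc k" "Suc n" q] m
    by (simp add: A_def B_def P_def C_def mult_ac del: qbinomial.simps)
  have "(qbinomial q n k + q ^ Suc k * qbinomial q n (Suc k)) * C =
      (qbinomial q n k * A * (B * (1 - q ^ Suc m))) * (1 - q ^ Suc k) +
      q ^ Suc k * (qbinomial q n (Suc k) * (A * (1 - q ^ Suc k)) * B) * (1 - q ^ Suc m)"
    unfolding C_def by (simp only: algebra_simps)
  also have "\<dots> = P * (1 - q ^ Suc k) + q ^ Suc k * P * (1 - q ^ Suc m)"
    unfolding 1 2 ..
  also have "\<dots> = P * (1 - q ^ Suc n)"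
    unfolding m by (simp add: algebra_simps power_add)
  finally have "(qbinomial q n k + q ^ Suc k * qbinomial q n (Suc k)) * C = qbinomial q (Suc n) (Suc k) * C"
    unfolding 3 .
  moreover have "C $ 0 = 1"
    using q by (simp add: C_def A_def B_def fps_nth_prod_0)
  hence "C \<noteq> 0" by auto
  ultimately show ?thesis
    by (metis mult_right_cancel)
next
  case False
  thus ?thesis by (cases "k = n") (simp_all add: qbinomial_eq_0)
qed

text \<open>For every integer, \<open>j * (j + 1)\<close> is even and nonnegative, so neither
  \<open>div\<close> nor \<open>nat\<close> loses anything; \<open>triangular (- j)\<close> is
  \<open>j * (j - 1) / 2\<close>.\<close>

definition triangular :: "int \<Rightarrow> nat" where
  "triangular j = nat (j * (j + 1) div 2)"

lemma of_nat_triangular: "2 * int (triangular j) = j * (j + 1)"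
proof -
  have "0 \<le> j * (j + 1)"
    by (cases "j \<ge> 0") (auto intro: mult_nonpos_nonpos)
  thus ?thesis
    by (simp add: triangular_def)
qed

text \<open>The general term of Ramanujan's theta function f(a, b), a sum over all integers.\<close>

definition theta_term :: "'a::comm_ring_1 \<Rightarrow> 'a \<Rightarrow> int \<Rightarrow> 'a" where
  "theta_term a b j = a ^ triangular j * b ^ triangular (- j)"

lemma theta_term_0 [simp]: "theta_term a b 0 = 1"
  by (simp add: theta_term_def triangular_def)

text \<open>Consecutive terms have the formal ratio \<open>a * (a * b) ^ j\<close> with
  \<open>j\<close> of either sign; multiplying through by \<open>(a * b) ^ (m - j)\<close> keeps the
  exponents nonnegative.\<close>

lemma theta_term_step_up:
  assumes "j \<le> int m"
  shows "a * (a * b) ^ m * theta_term a b j = (a * b) ^ nat (int m - j) * theta_term a b (j + 1)"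
proof -
  have "2 * int (Suc m + triangular j) = 2 * int (nat (int m - j) + triangular (j + 1))"
    using assms of_nat_triangular[of j] of_nat_triangular[of "j + 1"] by (simp add: algebra_simps)
  hence 1: "Suc m + triangular j = nat (int m - j) + triangular (j + 1)"
    by (metis mult_cancel_left of_nat_eq_iff zero_neq_numeral)
  have "2 * int (m + triangular (- j)) = 2 * int (nat (int m - j) + triangular (- (j + 1)))"
    using assms of_nat_triangular[of "-j"] of_nat_triangular[of "- (j + 1)"] by (simp add: algebra_simps)
  hence 2: "m + triangular (- j) = nat (int m - j) + triangular (- (j + 1))"
    by (metis mult_cancel_left of_nat_eq_iff zero_neq_numeral)
  have "a * (a * b) ^ m * theta_term a b j = a ^ (Suc m + triangular j) * b ^ (m + triangular (- j))"
    by (simp add: theta_term_def power_add power_mult_distrib mult_ac)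
  also have "\<dots> = (a * b) ^ nat (int m - j) * theta_term a b (j + 1)"
    unfolding 1 2 by (simp add: theta_term_def power_add power_mult_distrib mult_ac)
  finally show ?thesis .
qed

lemma theta_term_swap: "theta_term a b (- j) = theta_term b a j"
  by (simp add: theta_term_def mult.commute)

lemma theta_term_step_down:
  assumes "- int n \<le> j"
  shows "b * (a * b) ^ n * theta_term a b j = (a * b) ^ nat (int n + j) * theta_term a b (j - 1)"
  using theta_term_step_up[of "- j" n b a] assms theta_term_swap[of a b "-j"] theta_term_swap[of a b "1 - j"]
  by (simp add: theta_term_swap mult.commute add.commute)

text \<open>A symmetric form of the q-binomial theorem. A new factor in \<open>b\<close> is absorbed
  by the second q-Pascal rule and a downward theta step, a new factor in \<open>a\<close> by the
  defining rule and an upward step.\<close>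

lemma finite_triple_product:
  fixes a b :: "'a::idom fps"
  assumes "a $ 0 = 0"
  shows "(\<Prod>k<m. 1 + a * (a * b) ^ k) * (\<Prod>k<n. 1 + b * (a * b) ^ k) =
    (\<Sum>k\<le>m + n. qbinomial (a * b) (m + n) k * theta_term a b (int k - int n))"
proof (induction m)
  case 0
  show ?case
  proof (induction n)
    case (Suc n)
    let ?q = "a * b" and ?t = "theta_term a b"
    have "(\<Sum>k\<le>Suc n. qbinomial ?q (Suc n) k * ?t (int k - int (Suc n))) =
        ?t (- int (Suc n)) + (\<Sum>k\<le>n. qbinomial ?q (Suc n) (Suc k) * ?t (int k - int n))"
      by (subst sum.atMost_Suc_shift) (simp del: qbinomial.simps(3))
    also have "(\<Sum>k\<le>n. qbinomial ?q (Suc n) (Suc k) * ?t (int k - int n)) =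
        (\<Sum>k\<le>n. qbinomial ?q n k * ?t (int k - int n)) +
        (\<Sum>k\<le>n. ?q ^ Suc k * qbinomial ?q n (Suc k) * ?t (int k - int n))"
      using assms by (subst qbinomial_Suc_Suc') (simp_all add: ring_distribs sum.distrib)
    also have "?t (- int (Suc n)) + (\<dots>) = (\<Sum>k\<le>n. qbinomial ?q n k * ?t (int k - int n)) +
        (\<Sum>k\<le>Suc n. ?q ^ k * qbinomial ?q n k * ?t (int k - int (Suc n)))"
      by (subst sum.atMost_Suc_shift) simp
    also have "(\<Sum>k\<le>Suc n. ?q ^ k * qbinomial ?q n k * ?t (int k - int (Suc n))) =
        (\<Sum>k\<le>n. ?q ^ k * qbinomial ?q n k * ?t (int k - int (Suc n)))"
      by (simp add: qbinomial_eq_0)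
    \<comment> \<open>The Pascal weight \<open>?q ^ k\<close> is exactly the power in the downward
      theta step at \<open>j = k - n\<close>.\<close>
    also have "\<dots> = (\<Sum>k\<le>n. b * ?q ^ n * (qbinomial ?q n k * ?t (int k - int n)))"
    proof (rule sum.cong[OF refl])
      fix k
      have eq: "b * ?q ^ n * ?t (int k - int n) = ?q ^ k * ?t (int k - int (Suc n))"
        using theta_term_step_down[of n "int k - int n" b a] by (simp add: algebra_simps)
      have "?q ^ k * qbinomial ?q n k * ?t (int k - int (Suc n)) =
          qbinomial ?q n k * (?q ^ k * ?t (int k - int (Suc n)))"
        by (rule mult.left_commute[THEN trans[OF mult.assoc]])
      thus "?q ^ k * qbinomial ?q n k * ?t (int k - int (Suc n)) =
          b * ?q ^ n * (qbinomial ?q n k * ?t (int k - int n))"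
        unfolding eq[symmetric] by (simp only: mult.left_commute)
    qed
    finally show ?case
      using Suc.IH by (simp add: sum_distrib_left[symmetric] algebra_simps)
  qed simp
next
  case (Suc m)
  let ?q = "a * b" and ?t = "theta_term a b"
  define N where "N = m + n"
  have "(\<Sum>k\<le>Suc N. qbinomial ?q (Suc N) k * ?t (int k - int n)) =
      ?t (- int n) + (\<Sum>k\<le>N. qbinomial ?q N (Suc k) * ?t (int (Suc k) - int n)) +
      (\<Sum>k\<le>N. ?q ^ (N - k) * qbinomial ?q N k * ?t (int (Suc k) - int n))"
    by (subst sum.atMost_Suc_shift) (simp add: ring_distribs sum.distrib)
  also have "?t (- int n) + (\<Sum>k\<le>N. qbinomial ?q N (Suc k) * ?t (int (Suc k) - int n)) =
      (\<Sum>k\<le>Suc N. qbinomial ?q N k * ?t (int k - int n))"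
    by (subst sum.atMost_Suc_shift) simp
  also have "\<dots> = (\<Sum>k\<le>N. qbinomial ?q N k * ?t (int k - int n))"
    by (simp add: qbinomial_eq_0)
  also have "(\<Sum>k\<le>N. ?q ^ (N - k) * qbinomial ?q N k * ?t (int (Suc k) - int n)) =
      (\<Sum>k\<le>N. a * ?q ^ m * (qbinomial ?q N k * ?t (int k - int n)))"
  proof (rule sum.cong[OF refl])
    fix k assume k: "k \<in> {..N}"
    hence "nat (int m - (int k - int n)) = N - k"
      by (simp add: N_def)
    hence eq: "a * ?q ^ m * ?t (int k - int n) = ?q ^ (N - k) * ?t (int (Suc k) - int n)"
      using theta_term_step_up[of "int k - int n" m a b] k by (simp add: N_def algebra_simps)
    have "?q ^ (N - k) * qbinomial ?q N k * ?t (int (Suc k) - int n) =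
        qbinomial ?q N k * (?q ^ (N - k) * ?t (int (Suc k) - int n))"
      by (rule mult.left_commute[THEN trans[OF mult.assoc]])
    thus "?q ^ (N - k) * qbinomial ?q N k * ?t (int (Suc k) - int n) =
        a * ?q ^ m * (qbinomial ?q N k * ?t (int k - int n))"
      unfolding eq[symmetric] by (simp only: mult.left_commute)
  qed
  finally show ?case
    using Suc.IH by (simp add: sum_distrib_left[symmetric] algebra_simps N_def)
qed

section \<open>The limit of the finite triple product\<close>

lemma fps_mult_nth_cong:
  assumes "\<And>i. i \<le> n \<Longrightarrow> f $ i = f' $ i" "\<And>i. i \<le> n \<Longrightarrow> g $ i = g' $ i" "i \<le> n"
  shows "(f * g) $ i = (f' * g') $ i"
  unfolding fps_mult_nth using assms by (intro sum.cong) auto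

lemma fps_nth_power_mult_power_eq_0:
  assumes "a $ 0 = 0" "b $ 0 = 0" "n < i + k"
  shows "(a ^ i * b ^ k :: 'a::comm_ring_1 fps) $ n = 0"
  unfolding fps_mult_nth
proof (rule sum.neutral, rule ballI)
  fix l assume "l \<in> {0..n}"
  hence "l < i \<or> n - l < k" using assms(3) by auto
  thus "a ^ i $ l * b ^ k $ (n - l) = 0"
    using startsby_zero_power_prefix[OF assms(1), of i] startsby_zero_power_prefix[OF assms(2), of k] by auto
qed

text \<open>The exponents of \<open>a\<close> and \<open>b\<close> add up to \<open>j ^ 2\<close>,
  which bounds the order of the term from below.\<close>

lemma fps_nth_theta_term_eq_0:
  assumes "a $ 0 = 0" "b $ 0 = 0" "int n < j ^ 2"
  shows "(theta_term a b j :: 'a::comm_ring_1 fps) $ n = 0"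
proof -
  have "int (triangular j + triangular (- j)) = j ^ 2"
    using of_nat_triangular[of j] of_nat_triangular[of "- j"] by (simp add: algebra_simps power2_eq_square)
  thus ?thesis
    unfolding theta_term_def using assms by (intro fps_nth_power_mult_power_eq_0) linarith+
qed

text \<open>Up to degree \<open>d\<close> all three q-factorials in the quotient formula agree with
  \<open>R\<close>, so \<open>qbinomial q N k * R * R\<close> agrees with \<open>R\<close>; one
  \<open>R\<close>, of constant term 1, cancels.\<close>

lemma fps_nth_qbinomial_mult_qpochhammer:
  fixes q :: "'a::field fps"
  assumes q: "q $ 0 = 0" and "d < k" "d < N - k" "i \<le> d"
  shows "(qbinomial q N k * qpochhammer_inf q q) $ i = (1 :: 'a fps) $ i"
proof -
  define R where "R = qpochhammer_inf q q"
  define F where "F m = (\<Prod>i<m. 1 - q ^ Suc i)" for m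
  have F: "F m $ i = R $ i" if "d < m" "i \<le> d" for m i
    using fps_nth_qpochhammer_inf[of q q i m] that q by (simp add: F_def R_def)
  have inv: "R * inverse R = 1"
    using q by (simp add: R_def mult.commute[of _ "inverse _"] inverse_mult_eq_1)
  have "(qbinomial q N k * R * R) $ i = R $ i" if "i \<le> d" for i
  proof -
    have "(qbinomial q N k * R * R) $ i = (qbinomial q N k * F k * F (N - k)) $ i"
      using assms that by (intro fps_mult_nth_cong[of d]) (auto simp: F)
    also have "qbinomial q N k * F k * F (N - k) = F N"
      unfolding F_def using assms by (intro qbinomial_mult_qfactorials) auto
    also have "F N $ i = R $ i"
      using assms that by (intro F) auto
    finally show ?thesis .
  qed
  hence "(qbinomial q N k * R * R * inverse R) $ i = (R * inverse R) $ i"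
    using assms by (intro fps_mult_nth_cong[of d]) auto
  thus ?thesis
    using inv by (simp add: mult.assoc R_def)
qed

text \<open>Ramanujan's f(a, b) in product form; the triple product identifies it with the sum of
  \<open>theta_term\<close>.\<close>

definition theta :: "'a::idom fps \<Rightarrow> 'a fps \<Rightarrow> 'a fps" where
  "theta a b = qpochhammer_inf (- a) (a * b) * qpochhammer_inf (- b) (a * b) * qpochhammer_inf (a * b) (a * b)"

theorem jacobi_triple_product:
  fixes a b :: "'a::field fps"
  assumes a: "a $ 0 = 0" and b: "b $ 0 = 0"
  shows "(theta_term a b has_sum theta a b) UNIV"
proof (rule has_sum_fpsI)
  fix d :: nat
  \<comment> \<open>Terms with \<open>j\<close> outside -d..d vanish in degree \<open>d\<close>. For
    the others \<open>n + j\<close> and \<open>n - j\<close> both exceed \<open>d\<close>, as the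
    limit of the q-binomials requires.\<close>
  define n where "n = 2 * d + 1"
  let ?q = "a * b" and ?t = "theta_term a b"
  have zero: "?t j $ i = 0" if "i \<le> d" "\<bar>j\<bar> > int d" for i :: nat and j :: int
  proof (rule fps_nth_theta_term_eq_0[OF a b])
    have "\<bar>j\<bar> * 1 \<le> \<bar>j\<bar> * \<bar>j\<bar>" using that by (intro mult_left_mono) auto
    thus "int i < j ^ 2" using that by (simp add: power2_eq_square)
  qed
  have subset: "{j. ?t j $ d \<noteq> 0} \<subseteq> {- int n..int n}"
  proof
    fix j assume "j \<in> {j. ?t j $ d \<noteq> 0}"
    hence "\<bar>j\<bar> \<le> int d" using zero[of d j] by force
    thus "j \<in> {- int n..int n}" by (auto simp: n_def)
  qed
  thus "finite {j \<in> UNIV. ?t j $ d \<noteq> 0}"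
    by (auto intro: finite_subset)
  define R where "R = qpochhammer_inf ?q ?q"
  have q: "?q $ 0 = 0" using a by simp
  have "theta a b $ d = ((\<Prod>k<n. 1 + a * ?q ^ k) * (\<Prod>k<n. 1 + b * ?q ^ k) * R) $ d"
    unfolding theta_def R_def
    using fps_nth_qpochhammer_inf[of "- a" ?q _ n] fps_nth_qpochhammer_inf[of "- b" ?q _ n] a b q
    by (intro fps_mult_nth_cong[of d]) (auto simp: n_def)
  also have "\<dots> = (\<Sum>k\<le>2 * n. (qbinomial ?q (2 * n) k * R * ?t (int k - int n)) $ d)"
    unfolding finite_triple_product[OF a]
    by (simp only: mult_2 sum_distrib_right fps_sum_nth) (simp only: mult_ac)
  also have "\<dots> = (\<Sum>k\<le>2 * n. ?t (int k - int n) $ d)"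
  proof (rule sum.cong[OF refl])
    fix k assume k: "k \<in> {..2 * n}"
    show "(qbinomial ?q (2 * n) k * R * ?t (int k - int n)) $ d = ?t (int k - int n) $ d"
    proof (cases "\<bar>int k - int n\<bar> > int d")
      case True
      thus ?thesis
        using zero[of _ "int k - int n"] by (simp add: fps_mult_nth)
    next
      case False
      hence "(qbinomial ?q (2 * n) k * R * ?t (int k - int n)) $ d = (1 * ?t (int k - int n)) $ d"
        unfolding R_def by (intro fps_mult_nth_cong[of d] fps_nth_qbinomial_mult_qpochhammer[OF q, of d])
          (auto simp: n_def)
      thus ?thesis by simp
    qed
  qed
  also have "\<dots> = (\<Sum>j\<in>{- int n..int n}. ?t j $ d)"
    by (rule sum.reindex_bij_witness[of _ "\<lambda>j. nat (j + int n)" "\<lambda>k. int k - int n"]) auto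
  also have "\<dots> = (\<Sum>j | j \<in> UNIV \<and> ?t j $ d \<noteq> 0. ?t j $ d)"
    by (rule sum.mono_neutral_right) (use subset in auto)
  finally show "theta a b $ d = \<dots>" .
qed

lemma theta_compose:
  fixes a b c :: "'a::idom fps"
  assumes "a $ 0 = 0" "b $ 0 = 0" "c $ 0 = 0"
  shows "theta a b oo c = theta (a oo c) (b oo c)"
  using assms
  by (simp add: theta_def fps_compose_mult_distrib qpochhammer_inf_compose fps_compose_uminus)

subsection \<open>Trisection of theta series\<close>

lemma has_sum_int_mod2:
  fixes f :: "int \<Rightarrow> 'a::topological_comm_monoid_add"
  assumes "((\<lambda>m. f (2 * m)) has_sum A) UNIV" "((\<lambda>m. f (2 * m - 1)) has_sum B) UNIV"
  shows "(f has_sum (A + B)) UNIV"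
proof -
  have "(f has_sum A) (range (\<lambda>m. 2 * m))" "(f has_sum B) (range (\<lambda>m. 2 * m - 1))"
    using assms by (subst has_sum_reindex; simp add: inj_def o_def)+
  moreover have "range (\<lambda>m::int. 2 * m) \<inter> range (\<lambda>m. 2 * m - 1) = {}"
    by (auto simp: disjoint_iff) presburger
  ultimately have "(f has_sum (A + B)) (range (\<lambda>m. 2 * m) \<union> range (\<lambda>m. 2 * m - 1))"
    by (rule has_sum_Un_disjoint)
  moreover have "j \<in> range (\<lambda>m. 2 * m) \<union> range (\<lambda>m. 2 * m - 1)" for j :: int
    by (auto simp: image_iff) presburger
  ultimately show ?thesis
    by (metis UNIV_eq_I)
qed

lemma has_sum_int_mod3:
  fixes f :: "int \<Rightarrow> 'a::topological_comm_monoid_add"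
  assumes "((\<lambda>m. f (3 * m)) has_sum A) UNIV" "((\<lambda>m. f (3 * m + 1)) has_sum B) UNIV"
    "((\<lambda>m. f (3 * m - 1)) has_sum C) UNIV"
  shows "(f has_sum (A + B + C)) UNIV"
proof -
  have "(f has_sum A) (range (\<lambda>m. 3 * m))" "(f has_sum B) (range (\<lambda>m. 3 * m + 1))"
    "(f has_sum C) (range (\<lambda>m. 3 * m - 1))"
    using assms by (subst has_sum_reindex; simp add: inj_def o_def)+
  moreover have "range (\<lambda>m::int. 3 * m) \<inter> range (\<lambda>m. 3 * m + 1) = {}"
    "(range (\<lambda>m::int. 3 * m) \<union> range (\<lambda>m. 3 * m + 1)) \<inter> range (\<lambda>m. 3 * m - 1) = {}"
    by (auto simp: disjoint_iff) presburger+
  ultimately have "(f has_sum (A + B + C)) (range (\<lambda>m. 3 * m) \<union> range (\<lambda>m. 3 * m + 1) \<union> range (\<lambda>m. 3 * m - 1))"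
    by (intro has_sum_Un_disjoint)
  moreover have "j \<in> range (\<lambda>m. 3 * m) \<union> range (\<lambda>m. 3 * m + 1) \<union> range (\<lambda>m. 3 * m - 1)" for j :: int
    by (auto simp: image_iff) presburger
  ultimately show ?thesis
    by (metis UNIV_eq_I)
qed

lemma theta_commute: "theta a b = theta b a"
  by (simp add: theta_def mult_ac)

text \<open>Comparing doubled exponents turns an identity of theta terms into a polynomial identity
  in the summation index.\<close>

lemma theta_term_power_eq:
  fixes x :: "'a::comm_ring_1"
  assumes "int i * (j * (j + 1)) + int k * (j * (j - 1)) =
    2 * int s + int i' * (j' * (j' + 1)) + int k' * (j' * (j' - 1))"
  shows "theta_term (x ^ i) (x ^ k) j = x ^ s * theta_term (x ^ i') (x ^ k') j'"
proof -
  have exponent: "2 * int (i * triangular j + k * triangular (- j)) =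
      int i * (j * (j + 1)) + int k * (j * (j - 1))" for i k j
  proof -
    have "2 * int (i * triangular j + k * triangular (- j)) =
        int i * (2 * int (triangular j)) + int k * (2 * int (triangular (- j)))"
      by simp
    thus ?thesis
      unfolding of_nat_triangular by (simp add: algebra_simps)
  qed
  have "2 * int (i * triangular j + k * triangular (- j)) =
      2 * int (s + (i' * triangular j' + k' * triangular (- j')))"
    unfolding of_nat_add[of s] distrib_left[of 2 "int s"] exponent assms by (simp only: add.assoc)
  hence eq: "i * triangular j + k * triangular (- j) = s + (i' * triangular j' + k' * triangular (- j'))"
    by (metis mult_cancel_left of_nat_eq_iff zero_neq_numeral)
  show ?thesis
    unfolding theta_term_def power_mult[symmetric] power_add[symmetric] eq ..
qed

text \<open>The terms are \<open>x ^ (j ^ 2)\<close>; the classes 1 and -1 of \<open>j\<close>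
  modulo 3 give the same series by the symmetry of \<open>theta\<close>, hence the factor 2.\<close>

lemma theta_dissection_phi:
  fixes x :: "'a::field fps"
  assumes x: "x $ 0 = 0"
  shows "theta x x = theta (x ^ 9) (x ^ 9) + 2 * x * theta (x ^ 15) (x ^ 3)"
proof -
  have JTP: "(theta_term (x ^ i) (x ^ k) has_sum theta (x ^ i) (x ^ k)) UNIV" if "i > 0" "k > 0" for i k
    using x that by (intro jacobi_triple_product) auto
  have "(theta_term (x ^ 1) (x ^ 1) has_sum
      (theta (x ^ 9) (x ^ 9) + x ^ 1 * theta (x ^ 15) (x ^ 3) + x ^ 1 * theta (x ^ 3) (x ^ 15))) UNIV"
  proof (rule has_sum_int_mod3)
    have "theta_term (x ^ 1) (x ^ 1) (3 * m) = x ^ 0 * theta_term (x ^ 9) (x ^ 9) m" for m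
      by (rule theta_term_power_eq) (simp add: algebra_simps)
    thus "((\<lambda>m. theta_term (x ^ 1) (x ^ 1) (3 * m)) has_sum theta (x ^ 9) (x ^ 9)) UNIV"
      using JTP[of 9 9] by simp
    have "theta_term (x ^ 1) (x ^ 1) (3 * m + 1) = x ^ 1 * theta_term (x ^ 15) (x ^ 3) m" for m
      by (rule theta_term_power_eq) (simp add: algebra_simps)
    thus "((\<lambda>m. theta_term (x ^ 1) (x ^ 1) (3 * m + 1)) has_sum x ^ 1 * theta (x ^ 15) (x ^ 3)) UNIV"
      using has_sum_cmult_right[OF JTP[of 15 3]] by simp
    have "theta_term (x ^ 1) (x ^ 1) (3 * m - 1) = x ^ 1 * theta_term (x ^ 3) (x ^ 15) m" for m
      by (rule theta_term_power_eq) (simp add: algebra_simps)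
    thus "((\<lambda>m. theta_term (x ^ 1) (x ^ 1) (3 * m - 1)) has_sum x ^ 1 * theta (x ^ 3) (x ^ 15)) UNIV"
      using has_sum_cmult_right[OF JTP[of 3 15]] by simp
  qed
  from has_sum_unique[OF JTP[of 1 1] this] show ?thesis
    by (simp add: theta_commute[of "x ^ 3"] algebra_simps)
qed

text \<open>The exponents are \<open>2 * j ^ 2 + j\<close>. The classes 0 and 1 of \<open>j\<close>
  modulo 3 reassemble, as even and odd terms, into \<open>theta (x ^ 6) (x ^ 3)\<close>; the class
  -1 gives the other series.\<close>

lemma theta_dissection_psi:
  fixes x :: "'a::field fps"
  assumes x: "x $ 0 = 0"
  shows "theta (x ^ 3) x = theta (x ^ 6) (x ^ 3) + x * theta (x ^ 27) (x ^ 9)"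
proof -
  have JTP: "(theta_term (x ^ i) (x ^ k) has_sum theta (x ^ i) (x ^ k)) UNIV" if "i > 0" "k > 0" for i k
    using x that by (intro jacobi_triple_product) auto
  have "(theta_term (x ^ 6) (x ^ 3) has_sum (theta (x ^ 21) (x ^ 15) + x ^ 3 * theta (x ^ 3) (x ^ 33))) UNIV"
  proof (rule has_sum_int_mod2)
    have "theta_term (x ^ 6) (x ^ 3) (2 * m) = x ^ 0 * theta_term (x ^ 21) (x ^ 15) m" for m
      by (rule theta_term_power_eq) (simp add: algebra_simps)
    thus "((\<lambda>m. theta_term (x ^ 6) (x ^ 3) (2 * m)) has_sum theta (x ^ 21) (x ^ 15)) UNIV"
      using JTP[of 21 15] by simp
    have "theta_term (x ^ 6) (x ^ 3) (2 * m - 1) = x ^ 3 * theta_term (x ^ 3) (x ^ 33) m" for m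
      by (rule theta_term_power_eq) (simp add: algebra_simps)
    thus "((\<lambda>m. theta_term (x ^ 6) (x ^ 3) (2 * m - 1)) has_sum x ^ 3 * theta (x ^ 3) (x ^ 33)) UNIV"
      using has_sum_cmult_right[OF JTP[of 3 33]] by simp
  qed
  from has_sum_unique[OF JTP[of 6 3] this]
  have c: "theta (x ^ 6) (x ^ 3) = theta (x ^ 21) (x ^ 15) + x ^ 3 * theta (x ^ 3) (x ^ 33)"
    by simp
  have "(theta_term (x ^ 3) (x ^ 1) has_sum
      (theta (x ^ 21) (x ^ 15) + x ^ 3 * theta (x ^ 33) (x ^ 3) + x ^ 1 * theta (x ^ 9) (x ^ 27))) UNIV"
  proof (rule has_sum_int_mod3)
    have "theta_term (x ^ 3) (x ^ 1) (3 * m) = x ^ 0 * theta_term (x ^ 21) (x ^ 15) m" for m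
      by (rule theta_term_power_eq) (simp add: algebra_simps)
    thus "((\<lambda>m. theta_term (x ^ 3) (x ^ 1) (3 * m)) has_sum theta (x ^ 21) (x ^ 15)) UNIV"
      using JTP[of 21 15] by simp
    have "theta_term (x ^ 3) (x ^ 1) (3 * m + 1) = x ^ 3 * theta_term (x ^ 33) (x ^ 3) m" for m
      by (rule theta_term_power_eq) (simp add: algebra_simps)
    thus "((\<lambda>m. theta_term (x ^ 3) (x ^ 1) (3 * m + 1)) has_sum x ^ 3 * theta (x ^ 33) (x ^ 3)) UNIV"
      using has_sum_cmult_right[OF JTP[of 33 3]] by simp
    have "theta_term (x ^ 3) (x ^ 1) (3 * m - 1) = x ^ 1 * theta_term (x ^ 9) (x ^ 27) m" for m
      by (rule theta_term_power_eq) (simp add: algebra_simps)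
    thus "((\<lambda>m. theta_term (x ^ 3) (x ^ 1) (3 * m - 1)) has_sum x ^ 1 * theta (x ^ 9) (x ^ 27)) UNIV"
      using has_sum_cmult_right[OF JTP[of 9 27]] by simp
  qed
  from has_sum_unique[OF JTP[of 3 1] this] show ?thesis
    using c by (simp add: theta_commute[of "x ^ 9"] theta_commute[of "x ^ 33"])
qed

subsection \<open>Euler products\<close>

text \<open>The series \<open>E\<^sub>k\<close> of the introductory overview is
  \<open>euler (fps_X ^ k)\<close>.\<close>

definition euler :: "'a::idom fps \<Rightarrow> 'a fps" where
  "euler x = qpochhammer_inf x x"

lemma euler_nonzero: "x $ 0 = 0 \<Longrightarrow> euler x \<noteq> 0"
  by (simp add: euler_def qpochhammer_inf_nonzero)

lemma euler_compose: "x $ 0 = 0 \<Longrightarrow> c $ 0 = 0 \<Longrightarrow> euler x oo c = euler (x oo c)"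
  by (simp add: euler_def qpochhammer_inf_compose)

lemma qpochhammer_inf_split2:
  fixes a q :: "'a::idom fps"
  assumes "a $ 0 = 0" "q $ 0 = 0"
  shows "qpochhammer_inf a q = qpochhammer_inf a (q ^ 2) * qpochhammer_inf (a * q) (q ^ 2)"
  by (subst qpochhammer_inf_split[OF assms, of 2]) (simp_all add: numeral_2_eq_2)

lemma qpochhammer_inf_split3:
  fixes a q :: "'a::idom fps"
  assumes "a $ 0 = 0" "q $ 0 = 0"
  shows "qpochhammer_inf a q =
    qpochhammer_inf a (q ^ 3) * qpochhammer_inf (a * q) (q ^ 3) * qpochhammer_inf (a * q ^ 2) (q ^ 3)"
  by (subst qpochhammer_inf_split[OF assms, of 3]) (simp_all add: lessThan_nat_numeral lessThan_Suc mult_ac)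

lemma qpochhammer_inf_odd:
  fixes x :: "'a::idom fps"
  assumes "x $ 0 = 0"
  shows "qpochhammer_inf x (x ^ 2) * euler (x ^ 2) = euler x"
  using qpochhammer_inf_split2[OF assms assms] by (simp add: euler_def power2_eq_square)

lemma qpochhammer_inf_minus_self:
  fixes x :: "'a::idom fps"
  assumes "x $ 0 = 0"
  shows "qpochhammer_inf (- x) x * euler x = euler (x ^ 2)"
  using qpochhammer_inf_minus_mult[OF assms assms] by (simp add: euler_def mult.commute)

text \<open>
  The four theta products are Ramanujan's \<open>\<phi>(-x)\<close> and \<open>\<psi>(x)\<close> and the series \<open>\<Omega>(-x)\<close> and \<open>A(x)\<close>
  with \<open>\<phi>(-q) = \<phi>(-q\<^sup>9) - 2q \<Omega>(-q\<^sup>3)\<close> and \<open>\<psi>(q) = A(q\<^sup>3) + q \<psi>(q\<^sup>9)\<close>.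
\<close>

lemma theta_phi_product:
  fixes x :: "'a::idom fps"
  assumes "x $ 0 = 0"
  shows "theta (- x) (- x) * euler (x ^ 2) = euler x ^ 2"
proof -
  have "theta (- x) (- x) * euler (x ^ 2) = (qpochhammer_inf x (x ^ 2) * euler (x ^ 2)) ^ 2"
    by (simp add: theta_def euler_def power2_eq_square mult_ac)
  thus ?thesis
    using qpochhammer_inf_odd[OF assms] by simp
qed

lemma theta_psi_product:
  fixes x :: "'a::idom fps"
  assumes "x $ 0 = 0"
  shows "theta (x ^ 3) x * euler x = euler (x ^ 2) ^ 2"
proof -
  define y1 y2 where "y1 = qpochhammer_inf x (x ^ 2)" and "y2 = qpochhammer_inf (- x) (x ^ 2)"
  \<comment> \<open>Odd exponents are 1 or 3 modulo 4, so \<open>y2\<close> unites two factors of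
    the theta product.\<close>
  have "y2 = qpochhammer_inf (- x) ((x ^ 2) ^ 2) * qpochhammer_inf ((- x) * x ^ 2) ((x ^ 2) ^ 2)"
    unfolding y2_def using assms by (intro qpochhammer_inf_split2) auto
  moreover have "(- x) * x ^ 2 = - (x ^ 3)" "(x ^ 2) ^ 2 = x ^ 4" "x ^ 3 * x = x ^ 4"
    by algebra+
  ultimately have theta: "theta (x ^ 3) x = y2 * euler (x ^ 4)"
    by (simp add: theta_def euler_def)
  have "y1 * y2 = qpochhammer_inf (x ^ 2) ((x ^ 2) ^ 2)"
    unfolding y1_def y2_def using assms by (intro qpochhammer_inf_minus_mult) auto
  hence 1: "y1 * y2 * euler (x ^ 4) = euler (x ^ 2)"
    using qpochhammer_inf_odd[of "x ^ 2"] assms by simp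
  have 2: "y1 * euler (x ^ 2) = euler x"
    unfolding y1_def by (rule qpochhammer_inf_odd[OF assms])
  have "y2 * euler (x ^ 4) * (y1 * euler (x ^ 2)) = y1 * y2 * euler (x ^ 4) * euler (x ^ 2)"
    by (simp only: mult_ac)
  thus ?thesis
    unfolding theta 1 2 by (simp only: power2_eq_square)
qed

lemma theta_omega_product:
  fixes x :: "'a::idom fps"
  assumes "x $ 0 = 0"
  shows "theta (- (x ^ 5)) (- x) * euler (x ^ 2) * euler (x ^ 3) = euler x * euler (x ^ 6) ^ 2"
proof -
  \<comment> \<open>Odd exponents fall into the classes 1, 3, 5 modulo 6. The theta product has 1
    and 5; class 3 is \<open>euler (x ^ 3) / euler (x ^ 6)\<close>.\<close>
  define y1 y3 y5 where "y1 = qpochhammer_inf x (x ^ 6)" and "y3 = qpochhammer_inf (x ^ 3) (x ^ 6)"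
    and "y5 = qpochhammer_inf (x ^ 5) (x ^ 6)"
  have pow: "x * x ^ 2 = x ^ 3" "x * (x ^ 2) ^ 2 = x ^ 5" "(x ^ 2) ^ 3 = x ^ 6" "x ^ 5 * x = x ^ 6"
    by algebra+
  have "qpochhammer_inf x (x ^ 2) = y1 * y3 * y5"
    using qpochhammer_inf_split3[of x "x ^ 2"] assms unfolding pow y1_def y3_def y5_def by simp
  moreover have "qpochhammer_inf x (x ^ 2) * euler (x ^ 2) = euler x"
    by (rule qpochhammer_inf_odd[OF assms])
  moreover have "y3 * euler (x ^ 6) = euler (x ^ 3)"
    using qpochhammer_inf_odd[of "x ^ 3"] assms by (simp add: y3_def)
  moreover have "theta (- (x ^ 5)) (- x) = y5 * y1 * euler (x ^ 6)"
    by (simp add: theta_def euler_def y1_def y5_def pow)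
  ultimately show ?thesis
    by algebra
qed

lemma theta_A_product:
  fixes x :: "'a::idom fps"
  assumes "x $ 0 = 0"
  shows "theta (x ^ 2) x * euler x * euler (x ^ 6) = euler (x ^ 2) * euler (x ^ 3) ^ 2"
proof -
  \<comment> \<open>Exponents are sorted modulo 3. The theta product has classes 1 and 2; class 0 is
    \<open>euler (x ^ 6) / euler (x ^ 3)\<close>.\<close>
  define y1 y2 y3 where "y1 = qpochhammer_inf (- x) (x ^ 3)" and "y2 = qpochhammer_inf (- (x ^ 2)) (x ^ 3)"
    and "y3 = qpochhammer_inf (- (x ^ 3)) (x ^ 3)"
  have pow: "(- x) * x = - (x ^ 2)" "(- x) * x ^ 2 = - (x ^ 3)" "x ^ 2 * x = x ^ 3"
    by algebra+
  have "qpochhammer_inf (- x) x = y1 * y2 * y3"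
    using qpochhammer_inf_split3[of "- x" x] assms unfolding pow y1_def y2_def y3_def by simp
  moreover have "qpochhammer_inf (- x) x * euler x = euler (x ^ 2)"
    by (rule qpochhammer_inf_minus_self[OF assms])
  moreover have "y3 * euler (x ^ 3) = euler (x ^ 6)"
    using qpochhammer_inf_minus_self[of "x ^ 3"] assms by (simp add: y3_def)
  moreover have "theta (x ^ 2) x = y2 * y1 * euler (x ^ 3)"
    by (simp add: theta_def euler_def y1_def y2_def pow)
  ultimately show ?thesis
    by algebra
qed

text \<open>Sort the exponents modulo 3. Class 0 is unchanged by cube roots of unity and gives
  \<open>euler (x ^ 3)\<close> three times; the twisted copies of classes 1 and 2 multiply to the
  same classes in \<open>x ^ 3\<close>, which \<open>euler (x ^ 9)\<close> completes to a fourth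
  \<open>euler (x ^ 3)\<close>.\<close>

lemma euler_cube_roots:
  fixes x w :: "'a::idom fps"
  assumes x: "x $ 0 = 0" and w: "w ^ 2 + w + 1 = 0"
  shows "euler x * euler (w * x) * euler (w ^ 2 * x) * euler (x ^ 9) = euler (x ^ 3) ^ 4"
proof -
  have split: "euler y = qpochhammer_inf y (y ^ 3) * qpochhammer_inf (y ^ 2) (y ^ 3) * euler (y ^ 3)"
    if "y $ 0 = 0" for y :: "'a fps"
  proof -
    have "y * y = y ^ 2" "y * y ^ 2 = y ^ 3" by algebra+
    thus ?thesis
      using qpochhammer_inf_split3[OF that that] by (simp add: euler_def)
  qed
  have pow: "(w * x) ^ 2 = w ^ 2 * x ^ 2" "(w * x) ^ 3 = x ^ 3" "(w ^ 2 * x) ^ 2 = w * x ^ 2" "(w ^ 2 * x) ^ 3 = x ^ 3"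
    "(x ^ 2) ^ 3 = x ^ 6" "(x ^ 3) ^ 3 = x ^ 9" "(x ^ 3) ^ 2 = x ^ 6"
  proof -
    have "w ^ 3 = 1" "w ^ 4 = w" "w ^ 6 = 1"
      using w by algebra+
    thus "(w * x) ^ 2 = w ^ 2 * x ^ 2" "(w * x) ^ 3 = x ^ 3" "(w ^ 2 * x) ^ 2 = w * x ^ 2" "(w ^ 2 * x) ^ 3 = x ^ 3"
      "(x ^ 2) ^ 3 = x ^ 6" "(x ^ 3) ^ 3 = x ^ 9" "(x ^ 3) ^ 2 = x ^ 6"
      by (simp_all add: power_mult_distrib flip: power_mult)
  qed
  define a0 a1 a2 where "a0 = qpochhammer_inf x (x ^ 3)" and "a1 = qpochhammer_inf (w * x) (x ^ 3)"
    and "a2 = qpochhammer_inf (w ^ 2 * x) (x ^ 3)"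
  define b0 b1 b2 where "b0 = qpochhammer_inf (x ^ 2) (x ^ 3)" and "b1 = qpochhammer_inf (w * x ^ 2) (x ^ 3)"
    and "b2 = qpochhammer_inf (w ^ 2 * x ^ 2) (x ^ 3)"
  have "euler x = a0 * b0 * euler (x ^ 3)"
    unfolding a0_def b0_def by (rule split[OF x])
  \<comment> \<open>Squaring swaps \<open>w\<close> and \<open>w ^ 2\<close>, hence
    \<open>a1\<close> goes with \<open>b2\<close> and \<open>a2\<close> with
    \<open>b1\<close>.\<close>
  moreover have "euler (w * x) = a1 * b2 * euler (x ^ 3)"
    using split[of "w * x"] x unfolding pow a1_def b2_def by simp
  moreover have "euler (w ^ 2 * x) = a2 * b1 * euler (x ^ 3)"
    using split[of "w ^ 2 * x"] x unfolding pow a2_def b1_def by simp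
  moreover have "euler (x ^ 3) = (a0 * a1 * a2) * (b0 * b1 * b2) * euler (x ^ 9)"
  proof -
    have "a0 * a1 * a2 = qpochhammer_inf (x ^ 3) (x ^ 9)"
      using qpochhammer_inf_cube_root_mult[of x "x ^ 3" w] x w unfolding pow a0_def a1_def a2_def by simp
    moreover have "b0 * b1 * b2 = qpochhammer_inf (x ^ 6) (x ^ 9)"
      using qpochhammer_inf_cube_root_mult[of "x ^ 2" "x ^ 3" w] x w unfolding pow b0_def b1_def b2_def by simp
    ultimately show ?thesis
      using split[of "x ^ 3"] x unfolding pow by simp
  qed
  ultimately show ?thesis
    by algebra
qed

text \<open>The product is \<open>theta (- x) (- x) * theta (x ^ 3) x\<close>, and each factor is
  dissected. Stated through \<open>y\<close>, the four theta series are shared by all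
  \<open>x\<close> with the same cube, in particular by the conjugates of
  \<open>fps_X\<close>.\<close>

lemma euler_mult_dissection:
  fixes x :: "'a::field fps"
  assumes x: "x $ 0 = 0" and y: "x ^ 3 = y"
  shows "euler x * euler (x ^ 2) =
    (theta (- (y ^ 3)) (- (y ^ 3)) - 2 * x * theta (- (y ^ 5)) (- y)) * (theta (y ^ 2) y + x * theta (y ^ 9) (y ^ 3))"
proof -
  have "theta (- x) (- x) * theta (x ^ 3) x * (euler x * euler (x ^ 2)) =
      (theta (- x) (- x) * euler (x ^ 2)) * (theta (x ^ 3) x * euler x)"
    by (simp only: mult_ac)
  also have "\<dots> = euler x * euler (x ^ 2) * (euler x * euler (x ^ 2))"
    unfolding theta_phi_product[OF x] theta_psi_product[OF x] by (simp only: power2_eq_square mult_ac)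
  finally have "euler x * euler (x ^ 2) = theta (- x) (- x) * theta (x ^ 3) x"
    using x by (simp add: euler_nonzero)
  also have "theta (- x) (- x) = theta (- (y ^ 3)) (- (y ^ 3)) - 2 * x * theta (- (y ^ 5)) (- y)"
    using theta_dissection_phi[of "- x"] x by (simp add: y[symmetric] flip: power_mult)
  also have "theta (x ^ 3) x = theta (y ^ 2) y + x * theta (y ^ 9) (y ^ 3)"
    using theta_dissection_psi[of x] x by (simp add: y[symmetric] flip: power_mult)
  finally show ?thesis .
qed

lemma theta_phi_mult_psi:
  fixes y :: "'a::idom fps"
  assumes y: "y $ 0 = 0"
  shows "theta (- y) (- y) * theta (y ^ 3) y = euler y * euler (y ^ 2)"
proof -
  have "theta (- y) (- y) * theta (y ^ 3) y * (euler y * euler (y ^ 2)) =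
      (theta (- y) (- y) * euler (y ^ 2)) * (theta (y ^ 3) y * euler y)"
    by (simp only: mult_ac)
  also have "\<dots> = euler y * euler (y ^ 2) * (euler y * euler (y ^ 2))"
    unfolding theta_phi_product[OF y] theta_psi_product[OF y] by (simp only: power2_eq_square mult_ac)
  finally show ?thesis
    using y by (simp add: euler_nonzero)
qed

text \<open>Multiply the two product formulas and cancel. The value is that of
  \<open>theta_phi_mult_psi\<close> at \<open>y ^ 3\<close>, a coincidence on which the trisection
  rests.\<close>

lemma theta_omega_mult_A:
  fixes y :: "'a::idom fps"
  assumes y: "y $ 0 = 0"
  shows "theta (- (y ^ 5)) (- y) * theta (y ^ 2) y = euler (y ^ 3) * euler (y ^ 6)"
proof -
  define e where "e = euler y * euler (y ^ 2) * euler (y ^ 3) * euler (y ^ 6)"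
  have "theta (- (y ^ 5)) (- y) * theta (y ^ 2) y * e =
      (theta (- (y ^ 5)) (- y) * euler (y ^ 2) * euler (y ^ 3)) * (theta (y ^ 2) y * euler y * euler (y ^ 6))"
    unfolding e_def by (simp only: mult_ac)
  also have "\<dots> = euler (y ^ 3) * euler (y ^ 6) * e"
    unfolding theta_omega_product[OF y] theta_A_product[OF y] e_def by (simp only: power2_eq_square mult_ac)
  finally show ?thesis
    using y by (simp add: euler_nonzero e_def)
qed

section \<open>Coefficients in a residue class\<close>

lemma fps_nth_compose_X_power:
  fixes f :: "'a::comm_ring_1 fps"
  assumes "m > 0"
  shows "(f oo fps_X ^ m) $ n = (if m dvd n then f $ (n div m) else 0)"
proof -
  have "(f oo fps_X ^ m) $ n = (\<Sum>i\<in>{0..n}. if m * i = n then f $ i else 0)"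
    unfolding fps_compose_nth by (intro sum.cong) (auto simp flip: power_mult)
  also have "\<dots> = (\<Sum>i\<in>(if m dvd n then {n div m} else {}). f $ i)"
    using assms by (intro sum.mono_neutral_cong_right) (auto split: if_splits)
  finally show ?thesis by simp
qed

text \<open>A factor in powers of \<open>fps_X ^ m\<close> does not mix residue classes of
  exponents, so extracting one class commutes with it.\<close>

lemma fps_nth_mult_compose_X_power:
  fixes f g :: "'a::comm_ring_1 fps"
  assumes "r < m"
  shows "(f * (g oo fps_X ^ m)) $ (m * n + r) = (Abs_fps (\<lambda>n. f $ (m * n + r)) * g) $ n"
proof -
  have m: "m > 0" using assms by simp
  have "(f * (g oo fps_X ^ m)) $ (m * n + r) =
      (\<Sum>i\<in>{0..m * n + r}. (g oo fps_X ^ m) $ i * f $ (m * n + r - i))"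
    by (subst mult.commute) (simp add: fps_mult_nth)
  also have "\<dots> = (\<Sum>i\<in>(\<lambda>i. m * i) ` {0..n}. (g oo fps_X ^ m) $ i * f $ (m * n + r - i))"
  proof (rule sum.mono_neutral_right)
    show "(\<lambda>i. m * i) ` {0..n} \<subseteq> {0..m * n + r}"
      by (auto simp: trans_le_add1)
    show "\<forall>i\<in>{0..m * n + r} - (\<lambda>i. m * i) ` {0..n}. (g oo fps_X ^ m) $ i * f $ (m * n + r - i) = 0"
    proof
      fix i assume i: "i \<in> {0..m * n + r} - (\<lambda>i. m * i) ` {0..n}"
      have "\<not> m dvd i"
      proof
        assume "m dvd i"
        then obtain k where k: "i = m * k" ..
        have "m * k < m * Suc n" using i k assms by simp
        hence "k \<le> n" by (metis mult_less_cancel1 less_Suc_eq_le)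
        thus False using i k by auto
      qed
      thus "(g oo fps_X ^ m) $ i * f $ (m * n + r - i) = 0"
        using m by (simp add: fps_nth_compose_X_power)
    qed
  qed simp
  also have "\<dots> = (\<Sum>i\<in>{0..n}. g $ i * f $ (m * (n - i) + r))"
    using m by (subst sum.reindex) (auto simp: inj_on_def fps_nth_compose_X_power diff_mult_distrib2 intro!: sum.cong)
  also have "\<dots> = (Abs_fps (\<lambda>n. f $ (m * n + r)) * g) $ n"
    by (subst mult.commute) (simp add: fps_mult_nth)
  finally show ?thesis .
qed

subsection \<open>The generating function of \<open>PD\<close>\<close>

text \<open>
  Replacing each part \<open>t\<close> by \<open>t\<close> copies of itself turns a partition of \<open>n\<close> into a multiset of size
  \<open>n\<close> in which every \<open>t\<close> occurs a multiple of \<open>t\<close> times; these multisets index the expansion of a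
  product of power series.
\<close>
definition spread :: "nat multiset \<Rightarrow> nat multiset" where
  "spread m = (\<Sum>t\<in>#m. replicate_mset t t)"

lemma count_spread: "count (spread m) t = t * count m t"
  by (induction m) (auto simp: spread_def)

lemma size_spread: "size (spread m) = sum_mset m"
  by (induction m) (auto simp: spread_def)

lemma bij_betw_spread:
  assumes "n \<le> N"
  shows "bij_betw spread {m. 0 \<notin># m \<and> sum_mset m = n}
    {X \<in> multisets_of_size {1..N} n. \<forall>t\<in>{1..N}. t dvd count X t}"
proof (rule bij_betw_imageI)
  show "inj_on spread {m. 0 \<notin># m \<and> sum_mset m = n}"
  proof (rule inj_onI, rule multiset_eqI)
    fix m m' t
    assume *: "m \<in> {m. 0 \<notin># m \<and> sum_mset m = n}" "m' \<in> {m. 0 \<notin># m \<and> sum_mset m = n}" "spread m = spread m'"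
    show "count m t = count m' t"
    proof (cases "t = 0")
      \<comment> \<open>\<open>spread\<close> forgets copies of 0, so here the absence of the part 0
        decides.\<close>
      case True
      thus ?thesis using * by (simp add: not_in_iff)
    next
      case False
      thus ?thesis using arg_cong[OF *(3), of "\<lambda>X. count X t"] by (simp add: count_spread)
    qed
  qed
  show "spread ` {m. 0 \<notin># m \<and> sum_mset m = n} =
    {X \<in> multisets_of_size {1..N} n. \<forall>t\<in>{1..N}. t dvd count X t}"
  proof (intro equalityI subsetI)
    fix X assume "X \<in> spread ` {m. 0 \<notin># m \<and> sum_mset m = n}"
    then obtain m where m: "0 \<notin># m" "sum_mset m = n" "X = spread m" by auto
    have "t \<in> {1..N}" if "t \<in># X" for t
    proof -
      have "t \<in># m" "t \<noteq> 0"
        using that m(3) by (auto simp: count_spread simp flip: count_greater_zero_iff)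
      moreover from this(1) have "t \<le> n"
        using m(2) by (auto dest!: multi_member_split)
      ultimately show ?thesis using assms by auto
    qed
    thus "X \<in> {X \<in> multisets_of_size {1..N} n. \<forall>t\<in>{1..N}. t dvd count X t}"
      using m by (auto simp: multisets_of_size_def size_spread count_spread)
  next
    fix X assume X: "X \<in> {X \<in> multisets_of_size {1..N} n. \<forall>t\<in>{1..N}. t dvd count X t}"
    \<comment> \<open>The preimage divides each multiplicity by its part.\<close>
    define m where "m = (\<Sum>t\<in>{1..N}. replicate_mset (count X t div t) t)"
    have count: "count m t = (if t \<in> {1..N} then count X t div t else 0)" for t
      by (simp add: m_def count_sum)
    have "spread m = X"
    proof (rule multiset_eqI)
      fix t
      show "count (spread m) t = count X t"
        using X by (auto simp: count_spread count multisets_of_size_def count_eq_zero_iff)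
    qed
    moreover have "0 \<notin># m"
      using count[of 0] by (simp add: count_eq_zero_iff)
    moreover have "sum_mset m = n"
      using X \<open>spread m = X\<close> size_spread[of m] by (simp add: multisets_of_size_def)
    ultimately show "X \<in> spread ` {m. 0 \<notin># m \<and> sum_mset m = n}"
      by blast
  qed
qed

text \<open>Coefficient \<open>k\<close> counts the ways to mark one of \<open>k\<close> copies; the
  value 1 at 0 is the empty choice for a size that does not occur. In closed form this is 1 + X / (1
  - X)^2.\<close>

definition designation_series :: "'a::comm_ring_1 fps" where
  "designation_series = Abs_fps (\<lambda>k. if k = 0 then 1 else of_nat k)"

text \<open>The closed form has numerator 1 - X + X^2, and (1 + X) (1 - X + X^2) = 1 + X^3; only
  binomials remain, as infinite products need.\<close>

lemma designation_series_mult: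
  "designation_series * ((1 + fps_X) * (1 - fps_X) ^ 2) = (1 + fps_X ^ 3 :: 'a::comm_ring_1 fps)"
proof -
  define h :: "'a fps" where "h = Abs_fps (\<lambda>n. if n = 1 then 0 else 1)"
  have 1: "designation_series * (1 - fps_X) = h"
    by (rule fps_ext) (auto simp: designation_series_def h_def right_diff_distrib of_nat_diff)
  have 2: "h * (1 - fps_X) = 1 - fps_X + fps_X ^ 2"
    by (rule fps_ext) (auto simp: h_def right_diff_distrib fps_X_power_nth fps_X_nth)
  have "designation_series * ((1 + fps_X) * (1 - fps_X) ^ 2) =
      designation_series * (1 - fps_X) * (1 - fps_X) * (1 + fps_X :: 'a fps)"
    by (simp only: power2_eq_square mult_ac)
  also have "\<dots> = 1 + fps_X ^ 3"
    unfolding 1 2 by (simp add: algebra_simps power2_eq_square power3_eq_cube)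
  finally show ?thesis .
qed

text \<open>The designations of a fixed multiset number the product of its multiplicities. Spreading
  turns multisets into distributions of the exponent \<open>n\<close> over the factors.\<close>

lemma PD_eq_fps_nth_prod:
  assumes "n \<le> N"
  shows "of_nat (PD n) = (\<Prod>t\<in>{1..N}. designation_series oo fps_X ^ t :: 'a::comm_ring_1 fps) $ n"
proof -
  define A where "A = {m :: nat multiset. 0 \<notin># m \<and> sum_mset m = n}"
  define B where "B = {X \<in> multisets_of_size {1..N} n. \<forall>t\<in>{1..N}. t dvd count X t}"
  have bij: "bij_betw spread A B"
    unfolding A_def B_def by (rule bij_betw_spread[OF assms])
  have fin: "finite (multisets_of_size {1..N} n)"
    by (rule finite_multisets_of_size) simp
  hence "finite B" by (simp add: B_def)
  hence "finite A" using bij_betw_finite[OF bij] by simp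
  have "designated_partitions n = (SIGMA m:A. \<Pi>\<^sub>E t\<in>set_mset m. {1..count m t})"
    by (auto simp: designated_partitions_def A_def)
  hence "PD n = (\<Sum>m\<in>A. \<Prod>t\<in>set_mset m. count m t)"
    using \<open>finite A\<close> by (simp add: PD_def card_PiE finite_PiE)
  hence "of_nat (PD n) = (\<Sum>m\<in>A. \<Prod>t\<in>set_mset m. of_nat (count m t) :: 'a)"
    by simp
  also have "\<dots> = (\<Sum>m\<in>A. \<Prod>t\<in>{1..N}. (designation_series oo fps_X ^ t) $ count (spread m) t)"
  proof (rule sum.cong[OF refl])
    fix m assume "m \<in> A"
    hence "set_mset m \<subseteq> {1..N}"
      using assms by (auto simp: A_def Suc_le_eq intro: gr0I dest!: multi_member_split)
    hence "(\<Prod>t\<in>set_mset m. of_nat (count m t) :: 'a) = (\<Prod>t\<in>{1..N}. designation_series $ count m t)"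
      by (intro prod.mono_neutral_cong_left) (auto simp: designation_series_def count_eq_zero_iff)
    also have "\<dots> = (\<Prod>t\<in>{1..N}. (designation_series oo fps_X ^ t) $ count (spread m) t)"
      by (intro prod.cong) (auto simp: fps_nth_compose_X_power count_spread)
    finally show "(\<Prod>t\<in>set_mset m. of_nat (count m t) :: 'a) = \<dots>" .
  qed
  also have "\<dots> = (\<Sum>X\<in>B. \<Prod>t\<in>{1..N}. (designation_series oo fps_X ^ t) $ count X t)"
    by (rule sum.reindex_bij_betw[OF bij])
  \<comment> \<open>Outside \<open>B\<close> some \<open>t\<close> does not divide
    \<open>count X t\<close>, and the corresponding coefficient is 0.\<close>
  also have "\<dots> = (\<Sum>X\<in>multisets_of_size {1..N} n. \<Prod>t\<in>{1..N}. (designation_series oo fps_X ^ t) $ count X t)"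
    by (intro sum.mono_neutral_left ballI prod_zero)
       (use fin in \<open>auto simp: B_def fps_nth_compose_X_power intro!: bexI\<close>)
  also have "\<dots> = (\<Prod>t\<in>{1..N}. designation_series oo fps_X ^ t :: 'a fps) $ n"
    by (rule fps_prod_nth'[symmetric]) simp
  finally show ?thesis .
qed

text \<open>Part size t contributes (1 + z^3) / ((1 + z) (1 - z)^2) with z = q^t. The product over
  all t is (-q^3; q^3) / ((-q; q) (q; q)^2), and \<open>qpochhammer_inf_minus_self\<close> turns it
  into Euler products.\<close>

lemma PD_generating_function:
  "Abs_fps (\<lambda>n. of_nat (PD n)) * (euler fps_X * euler (fps_X ^ 2) * euler (fps_X ^ 3)) =
    (euler (fps_X ^ 6) :: 'a::idom fps)"
proof -
  let ?X = "fps_X :: 'a fps"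
  define G where "G = Abs_fps (\<lambda>n. of_nat (PD n) :: 'a)"
  define F where "F t = designation_series oo ?X ^ t" for t
  have F: "F (Suc k) * ((1 - (- ?X) * ?X ^ k) * (1 - ?X * ?X ^ k) ^ 2) = 1 - (- (?X ^ 3)) * (?X ^ 3) ^ k" for k
  proof -
    define z where "z = ?X ^ Suc k"
    have z0: "z $ 0 = 0" by (simp add: z_def)
    have "(designation_series * ((1 + ?X) * (1 - ?X) ^ 2)) oo z = (1 + ?X ^ 3) oo z"
      by (simp only: designation_series_mult)
    hence "F (Suc k) * ((1 + z) * (1 - z) ^ 2) = 1 + z ^ 3"
      using z0 unfolding F_def z_def[symmetric]
      by (simp add: fps_compose_mult_distrib fps_compose_add_distrib fps_compose_sub_distrib
        fps_X_power_compose flip: fps_compose_power)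
    moreover have "z ^ 3 = ?X ^ 3 * (?X ^ 3) ^ k"
      unfolding z_def by (simp only: power_Suc power_mult_distrib power_mult[symmetric] mult.commute)
    ultimately show ?thesis
      by (simp add: z_def)
  qed
  have "(\<lambda>N. \<Prod>k<N. F (Suc k)) \<longlonglongrightarrow> G"
  proof (rule tendsto_fpsI)
    fix n
    show "\<forall>\<^sub>F N in sequentially. (\<Prod>k<N. F (Suc k)) $ n = G $ n"
      using eventually_ge_at_top[of n]
    proof eventually_elim
      case (elim N)
      have "(\<Prod>k<N. F (Suc k)) = prod F {1..N}"
        by (simp add: prod.atLeast1_atMost_eq)
      thus ?case
        using PD_eq_fps_nth_prod[OF elim, where 'a = 'a] by (simp add: G_def F_def)
    qed
  qed
  hence "(\<lambda>N. (\<Prod>k<N. F (Suc k)) * ((\<Prod>k<N. 1 - (- ?X) * ?X ^ k) * (\<Prod>k<N. 1 - ?X * ?X ^ k) ^ 2))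
      \<longlonglongrightarrow> G * (qpochhammer_inf (- ?X) ?X * euler ?X ^ 2)"
    unfolding euler_def power2_eq_square by (intro tendsto_mult qpochhammer_inf_LIMSEQ) auto
  hence "(\<lambda>N. \<Prod>k<N. 1 - (- (?X ^ 3)) * (?X ^ 3) ^ k) \<longlonglongrightarrow> G * (qpochhammer_inf (- ?X) ?X * euler ?X ^ 2)"
    unfolding F[symmetric] by (simp only: prod.distrib prod_power_distrib)
  hence "qpochhammer_inf (- (?X ^ 3)) (?X ^ 3) = G * (qpochhammer_inf (- ?X) ?X * euler ?X ^ 2)"
    by (intro qpochhammer_inf_eqI) auto
  moreover have "qpochhammer_inf (- (?X ^ 3)) (?X ^ 3) * euler (?X ^ 3) = euler (?X ^ 6)"
    using qpochhammer_inf_minus_self[of "?X ^ 3"] by simp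
  moreover have "qpochhammer_inf (- ?X) ?X * euler ?X = euler (?X ^ 2)"
    using qpochhammer_inf_minus_self[of ?X] by simp
  ultimately show ?thesis
    unfolding G_def[symmetric] by algebra
qed

subsection \<open>The residue class 2 modulo 3\<close>

lemma trisection_of_euler_quotient:
  fixes G :: "'a::field fps" and w :: 'a
  assumes w: "w ^ 2 + w + 1 = 0"
  assumes G: "G * (euler fps_X * euler (fps_X ^ 2) * euler (fps_X ^ 3)) = euler (fps_X ^ 6)"
  shows "Abs_fps (\<lambda>n. G $ (3 * n + 2)) * (euler fps_X ^ 5 * euler (fps_X ^ 2) ^ 3) =
    3 * euler (fps_X ^ 3) ^ 3 * euler (fps_X ^ 6) ^ 3"
proof -
  let ?X = "fps_X :: 'a fps"
  define v where "v = fps_const w"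
  have v: "v ^ 2 + v + 1 = 0"
    using w by (simp add: v_def fps_const_power fps_const_add flip: fps_const_1_eq_1)
  \<comment> \<open>The upper-case series below are these at \<open>y = fps_X ^ 3\<close>; the
    lower-case forms return when every third coefficient is extracted.\<close>
  define p b c s k where "p = theta (- (?X ^ 3)) (- (?X ^ 3))" and "b = theta (- (?X ^ 5)) (- ?X)"
    and "c = theta (?X ^ 2) ?X" and "s = theta (?X ^ 9) (?X ^ 3)" and "k = euler (?X ^ 3) * euler (?X ^ 6)"
  define y where "y = ?X ^ 3"
  define P B C S K where "P = theta (- (y ^ 3)) (- (y ^ 3))" and "B = theta (- (y ^ 5)) (- y)"
    and "C = theta (y ^ 2) y" and "S = theta (y ^ 9) (y ^ 3)" and "K = euler (y ^ 3) * euler (y ^ 6)"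
  have y0: "y $ 0 = 0" by (simp add: y_def)
  have compose: "p oo y = P" "b oo y = B" "c oo y = C" "s oo y = S" "k oo y = K"
    using y0 by (simp_all add: p_def b_def c_def s_def k_def P_def B_def C_def S_def K_def
      theta_compose euler_compose fps_compose_mult_distrib fps_compose_uminus fps_X_power_compose)
  have dissection: "euler x * euler (x ^ 2) = (P - 2 * x * B) * (C + x * S)" if "x $ 0 = 0" "x ^ 3 = y" for x
    unfolding P_def B_def C_def S_def by (rule euler_mult_dissection[OF that])
  have PS: "P * S = K"
    using theta_phi_mult_psi[of "y ^ 3"] y0 by (simp add: P_def S_def K_def flip: power_mult)
  have BC: "B * C = K"
    unfolding B_def C_def K_def by (rule theta_omega_mult_A[OF y0])
  define M where "M = euler (v * ?X) * euler ((v * ?X) ^ 2) * (euler (v ^ 2 * ?X) * euler ((v ^ 2 * ?X) ^ 2))"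
  \<comment> \<open>As PS = BC = K, the conjugates are PC - rXK - 2 r^2 X^2 BS with r =
    \<open>v\<close> and r = \<open>v ^ 2\<close>. In their product X^2 receives K^2 from the middle
    terms and 2 K^2 from pairing the outer ones.\<close>
  have M: "M = (P ^ 2 * C ^ 2 + ?X ^ 3 * (2 * P * B * S ^ 2 - 4 * B ^ 2 * C * S)) +
      ?X * (2 * P * B * C ^ 2 - P ^ 2 * C * S + ?X ^ 3 * (4 * B ^ 2 * S ^ 2)) + ?X ^ 2 * (3 * K ^ 2)"
  proof -
    have "(v * ?X) ^ 3 = y" "(v ^ 2 * ?X) ^ 3 = y"
      unfolding y_def using v by algebra+
    hence "M = (P - 2 * (v * ?X) * B) * (C + v * ?X * S) * ((P - 2 * (v ^ 2 * ?X) * B) * (C + v ^ 2 * ?X * S))"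
      unfolding M_def using dissection[of "v * ?X"] dissection[of "v ^ 2 * ?X"] by simp
    thus ?thesis
      using v PS BC by algebra
  qed
  \<comment> \<open>\<open>M\<close> is completed by the remaining conjugate, and
    \<open>euler_cube_roots\<close> is applied at X and X^2; the twists of X^2 are merely
    permuted.\<close>
  have norm: "euler ?X * euler (?X ^ 2) * M * K = euler y ^ 4 * euler (y ^ 2) ^ 4"
  proof -
    have pow: "(?X ^ 2) ^ 9 = y ^ 6" "?X ^ 9 = y ^ 3" "(?X ^ 2) ^ 3 = y ^ 2" "?X ^ 3 = y"
      "(v * ?X) ^ 2 = v ^ 2 * ?X ^ 2" "(v ^ 2 * ?X) ^ 2 = v * ?X ^ 2"
      using v unfolding y_def by algebra+
    have "euler ?X * euler (v * ?X) * euler (v ^ 2 * ?X) * euler (y ^ 3) = euler y ^ 4"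
      using euler_cube_roots[of ?X v] v unfolding pow by simp
    moreover have "euler (?X ^ 2) * euler (v * ?X ^ 2) * euler (v ^ 2 * ?X ^ 2) * euler (y ^ 6) = euler (y ^ 2) ^ 4"
      using euler_cube_roots[of "?X ^ 2" v] v unfolding pow by simp
    ultimately show ?thesis
      unfolding M_def K_def pow by algebra
  qed
  \<comment> \<open>\<open>D oo y\<close> is a series in X^3. Its exponents are 5 = 4 + 1 and 3 = 4
    - 1: fourth powers from \<open>norm\<close>, one \<open>euler y\<close> for the equation of
    \<open>G\<close>, one \<open>euler (y ^ 2)\<close> cancelled.\<close>
  define D where "D = euler ?X ^ 5 * euler (?X ^ 2) ^ 3"
  have D: "D oo y = euler y ^ 5 * euler (y ^ 2) ^ 3"
    using y0 by (simp add: D_def euler_compose fps_compose_mult_distrib fps_X_power_compose flip: fps_compose_power)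
  have "G * (D oo y) * euler (y ^ 2) = M * K * euler (y ^ 2)"
  proof -
    have "G * (D oo y) * euler (y ^ 2) = (G * euler y) * (euler y ^ 4 * euler (y ^ 2) ^ 4)"
      unfolding D by algebra
    also have "\<dots> = (G * (euler ?X * euler (?X ^ 2) * euler y)) * M * K"
      unfolding norm[symmetric] by algebra
    also have "G * (euler ?X * euler (?X ^ 2) * euler y) = euler (y ^ 2)"
      using G by (simp add: y_def flip: power_mult)
    finally show ?thesis
      by (simp only: mult_ac)
  qed
  hence GD: "G * (D oo y) = M * K"
    using y0 by (simp add: euler_nonzero)
  \<comment> \<open>The classes 0 and 1 of \<open>M * K\<close> as series in \<open>y\<close>; at
    exponents \<open>3 * n + 2\<close> only the third summand remains.\<close>
  define m0 m1 where "m0 = (p ^ 2 * c ^ 2 + ?X * (2 * p * b * s ^ 2 - 4 * b ^ 2 * c * s)) * k"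
    and "m1 = (2 * p * b * c ^ 2 - p ^ 2 * c * s + ?X * (4 * b ^ 2 * s ^ 2)) * k"
  have compose_m: "m0 oo y = (P ^ 2 * C ^ 2 + y * (2 * P * B * S ^ 2 - 4 * B ^ 2 * C * S)) * K"
    "m1 oo y = (2 * P * B * C ^ 2 - P ^ 2 * C * S + y * (4 * B ^ 2 * S ^ 2)) * K"
    "(3 * k ^ 3) oo y = 3 * K ^ 3"
    using y0 by (simp_all add: m0_def m1_def fps_compose_mult_distrib fps_compose_add_distrib
      fps_compose_sub_distrib compose flip: fps_compose_power)
  have GD': "G * (D oo y) = (m0 oo y) + ?X * (m1 oo y) + ?X ^ 2 * ((3 * k ^ 3) oo y)"
    unfolding GD M compose_m y_def[symmetric] by (simp add: algebra_simps power3_eq_cube power2_eq_square)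
  show ?thesis
  proof (rule fps_ext)
    fix n
    have "(Abs_fps (\<lambda>n. G $ (3 * n + 2)) * D) $ n = (G * (D oo y)) $ (3 * n + 2)"
      unfolding y_def by (rule fps_nth_mult_compose_X_power[symmetric]) simp
    also have "\<dots> = (3 * k ^ 3) $ n"
    proof -
      have "\<not> 3 dvd 3 * n + 2" "\<not> 3 dvd 3 * n + 1"
        by presburger+
      thus ?thesis
        unfolding GD' unfolding y_def
        by (simp add: fps_nth_compose_X_power fps_X_power_mult_nth)
    qed
    finally show "(Abs_fps (\<lambda>n. G $ (3 * n + 2)) * (euler ?X ^ 5 * euler (?X ^ 2) ^ 3)) $ n =
        (3 * euler (?X ^ 3) ^ 3 * euler (?X ^ 6) ^ 3) $ n"
      by (simp add: D_def k_def power_mult_distrib mult.assoc)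
  qed
qed

text \<open>
  The cube root of unity lives in the complex numbers, so the identity is transferred back to
  the rational coefficients.
\<close>
definition fps_of_rat :: "rat fps \<Rightarrow> complex fps" where
  "fps_of_rat f = Abs_fps (\<lambda>n. of_rat (f $ n))"

lemma fps_of_rat_mult: "fps_of_rat (f * g) = fps_of_rat f * fps_of_rat g"
  by (rule fps_ext) (simp add: fps_of_rat_def fps_mult_nth of_rat_sum of_rat_mult)

lemma fps_of_rat_1: "fps_of_rat 1 = 1"
  by (rule fps_ext) (simp add: fps_of_rat_def)

lemma fps_of_rat_power: "fps_of_rat (f ^ n) = fps_of_rat f ^ n"
  by (induction n) (simp_all add: fps_of_rat_1 fps_of_rat_mult)

lemma fps_of_rat_numeral: "fps_of_rat (numeral n) = numeral n"
  by (rule fps_ext) (simp add: fps_of_rat_def fps_numeral_nth)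

lemma fps_of_rat_X: "fps_of_rat fps_X = fps_X"
  by (rule fps_ext) (simp add: fps_of_rat_def fps_X_def)

lemma fps_of_rat_euler:
  assumes "k > 0"
  shows "fps_of_rat (euler (fps_X ^ k)) = euler (fps_X ^ k)"
proof -
  have "fps_of_rat (qpochhammer_inf (fps_X ^ k) (fps_X ^ k)) =
      qpochhammer_inf (fps_of_rat (fps_X ^ k)) (fps_of_rat (fps_X ^ k))"
    by (rule qpochhammer_inf_hom)
       (use assms in \<open>simp_all add: fps_of_rat_1 fps_of_rat_mult fps_of_rat_power fps_of_rat_X\<close>,
        simp_all add: fps_of_rat_def fps_eq_iff of_rat_diff)
  thus ?thesis
    by (simp add: euler_def fps_of_rat_power fps_of_rat_X)
qed

lemma inj_fps_of_rat: "inj fps_of_rat"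
  by (rule injI) (simp add: fps_of_rat_def fps_eq_iff)

lemma PD_trisection:
  "Abs_fps (\<lambda>n. of_nat (PD (3 * n + 2))) * (euler fps_X ^ 5 * euler (fps_X ^ 2) ^ 3) =
    (3 * euler (fps_X ^ 3) ^ 3 * euler (fps_X ^ 6) ^ 3 :: rat fps)" (is "?l = ?r")
proof (rule injD[OF inj_fps_of_rat])
  \<comment> \<open>The primitive cube root exp(2 pi i / 3).\<close>
  define w where "w = Complex (- 1 / 2) (sqrt 3 / 2)"
  have "w ^ 2 + w + 1 = 0"
    by (simp add: w_def complex_eq_iff power2_eq_square)
  from trisection_of_euler_quotient[OF this PD_generating_function]
  have "Abs_fps (\<lambda>n. of_nat (PD (3 * n + 2))) * (euler fps_X ^ 5 * euler (fps_X ^ 2) ^ 3) =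
      (3 * euler (fps_X ^ 3) ^ 3 * euler (fps_X ^ 6) ^ 3 :: complex fps)"
    by simp
  moreover have "fps_of_rat (Abs_fps (\<lambda>n. of_nat (PD (3 * n + 2)))) = Abs_fps (\<lambda>n. of_nat (PD (3 * n + 2)))"
    by (simp add: fps_of_rat_def)
  ultimately show "fps_of_rat ?l = fps_of_rat ?r"
    using fps_of_rat_euler[of 1]
    by (simp add: fps_of_rat_mult fps_of_rat_power fps_of_rat_numeral fps_of_rat_euler)
qed

theorem theorem1p3:
  shows "Abs_fps (\<lambda>n. of_nat (PD (3 * n + 2))) =
    (3 * (qpochhammer_inf (fps_X ^ 3) (fps_X ^ 6) ^ 3 * qpochhammer_inf (fps_X ^ 6) (fps_X ^ 6) ^ 6)
       / (qpochhammer_inf fps_X (fps_X ^ 2) ^ 5 * qpochhammer_inf (fps_X ^ 2) (fps_X ^ 2) ^ 8)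
     :: rat fps)"
proof -
  let ?X = "fps_X :: rat fps"
  define G where "G = Abs_fps (\<lambda>n. of_nat (PD (3 * n + 2)) :: rat)"
  define a b where "a = qpochhammer_inf ?X (?X ^ 2)" and "b = qpochhammer_inf (?X ^ 3) (?X ^ 6)"
  have a: "a * euler (?X ^ 2) = euler ?X"
    unfolding a_def by (rule qpochhammer_inf_odd) simp
  have b: "b * euler (?X ^ 6) = euler (?X ^ 3)"
    using qpochhammer_inf_odd[of "?X ^ 3"] by (simp add: b_def)
  \<comment> \<open>Eliminating \<open>euler ?X\<close> and \<open>euler (?X ^ 3)\<close> through
    \<open>a\<close> and \<open>b\<close> gives the exponents 8 = 5 + 3 and 6 = 3 + 3.\<close>
  have "G * (a ^ 5 * euler (?X ^ 2) ^ 8) = 3 * (b ^ 3 * euler (?X ^ 6) ^ 6)"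
    using PD_trisection a b unfolding G_def[symmetric] by algebra
  moreover have "a ^ 5 * euler (?X ^ 2) ^ 8 \<noteq> 0"
    by (simp add: a_def qpochhammer_inf_nonzero euler_nonzero)
  ultimately have "G = 3 * (b ^ 3 * euler (?X ^ 6) ^ 6) / (a ^ 5 * euler (?X ^ 2) ^ 8)"
    by (metis nonzero_mult_div_cancel_right)
  thus ?thesis
    unfolding G_def a_def b_def euler_def .
qed

end
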